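(* Let $\Omega\subset\mathbb{R}^n$ be a bounded domain and let $f=(H\circ \mathsf{y}+i\mathsf{y},\mathsf{t}):\Omega\to\mathbb{H}^1$ be a harmonic curve. If $$\mu:=\sup_{\Omega}\left|\frac{(H''\circ \mathsf{y})(H'\circ \mathsf{y})}{1+(H'\circ \mathsf{y})^2}\,\mathsf{y}\right|<1,$$ then there exists a positive constant $C(\mu)$, depending only on $\mu$, such that for every test function $\eta\in C_0^\infty(\Omega)$ $$\int_\Omega|\nabla \mathsf{y}|^2\eta^2\,dx\le C(\mu)\int_\Omega|\nabla\eta|^2\,\mathsf{y}^2\,dx .$$
   Context: The first Heisenberg group $\mathbb{H}^1$ is $\mathbb{R}^3$ with coordinates $(\mathsf{x},\mathsf{y},\mathsf{t})$ and contact form $\theta=d\mathsf{t}+2(\mathsf{x}\,d\mathsf{y}-\mathsf{y}\,d\mathsf{x})$. Let $\Omega\subset\mathbb{R}^n$ be a domain. A harmonic curve (also called $C^2$-harmonic mapping) is a $C^2$ map $f=(\mathsf{x},\mathsf{y},\mathsf{t}):\Omega\to\mathbb{H}^1$, also written $f=(\mathsf{z},\mathsf{t})$ with $\mathsf{z}=\mathsf{x}+i\mathsf{y}$, such that: (1) (isotropicity) $\frac{\partial\mathsf{x}}{\partial x_\alpha}\frac{\partial\mathsf{y}}{\partial x_\beta}-\frac{\partial\mathsf{x}}{\partial x_\beta}\frac{\partial\mathsf{y}}{\partial x_\alpha}=0$ for all $\alpha<\beta$, and the contact condition $f^*\theta=0$ holds, i.e. $\nabla\mathsf{t}=2(\mathsf{y}\nabla\mathsf{x}-\mathsf{x}\nabla\mathsf{y})$;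 (2) (criticality) $\mathsf{z}$ is a critical point of $E^2(f)=\int_\Omega|\nabla\mathsf{z}|^2dx$, where $|\nabla\mathsf{z}|^2=|\nabla\mathsf{x}|^2+|\nabla\mathsf{y}|^2$, with respect to domain variations $\mathsf{z}_s(x)=\mathsf{z}(x+s\xi(x))$, $\xi\in C_0^\infty(\Omega,\mathbb{R}^n)$; that is, for all $\phi\in C_0^\infty(\Omega)$ and $\gamma=1,\dots,n$, $$\int_\Omega\Big(|\nabla\mathsf{z}|^2\frac{\partial\phi}{\partial x_\gamma}-2\sum_{\beta=1}^n\Big(\frac{\partial\mathsf{x}}{\partial x_\beta}\frac{\partial\mathsf{x}}{\partial x_\gamma}+\frac{\partial\mathsf{y}}{\partial x_\beta}\frac{\partial\mathsf{y}}{\partial x_\gamma}\Big)\frac{\partial\phi}{\partial x_\beta}\Big)dx=0.$$ Throughout, $\mathsf{x}=H\circ\mathsf{y}$ for a $C^2$ function $H:I\to\mathbb{R}$ on an interval $I\supset\mathsf{y}(\Omega)$. For such maps, criticality is equivalent to $$\Delta\mathsf{y}=-\frac{(H''\circ\mathsf{y})(H'\circ\mathsf{y})}{1+(H'\circ\mathsf{y})^2}|\nabla\mathsf{y}|^2\quad\text{in }\Omega.$$ *)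

theory Defs
  imports "HOL-Analysis.Analysis"
begin

text \<open>
  The dimension \<open>n\<close> has to be a natural number that can be quantified inside a formula (constants
  are to be independent of it), so \<open>\<real>\<^sup>n\<close> is taken to be the set of functions
  \<open>{..<n} \<rightarrow>\<^sub>E UNIV\<close> with the topology \<open>powertop_real {..<n}\<close>. This set is also the space of the
  product measure \<open>lebesgue_Rn n\<close>, i.e. of \<open>n\<close>-dimensional Lebesgue measure (on Borel sets).
  Coordinates are numbered from \<open>0\<close> to \<open>n - 1\<close>.
\<close>

type_synonym point = "nat \<Rightarrow> real"

abbreviation Rn :: "nat \<Rightarrow> point topology" where
  "Rn n \<equiv> powertop_real {..<n}"

abbreviation lebesgue_Rn :: "nat \<Rightarrow> point measure" where
  "lebesgue_Rn n \<equiv> Pi\<^sub>M {..<n} (\<lambda>_. lborel)"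

definition bounded_domain :: "nat \<Rightarrow> point set \<Rightarrow> bool" where
  "bounded_domain n \<Omega> \<longleftrightarrow>
     openin (Rn n) \<Omega> \<and> connectedin (Rn n) \<Omega> \<and> \<Omega> \<noteq> {} \<and>
     (\<exists>B. \<forall>p\<in>\<Omega>. L2_set p {..<n} \<le> B)"

definition pderiv_at :: "nat \<Rightarrow> (point \<Rightarrow> real) \<Rightarrow> point \<Rightarrow> real" where
  "pderiv_at i u p = deriv (\<lambda>s. u (p(i := s))) (p i)"

definition has_pderiv_at :: "nat \<Rightarrow> (point \<Rightarrow> real) \<Rightarrow> point \<Rightarrow> bool" where
  "has_pderiv_at i u p \<longleftrightarrow> (\<lambda>s. u (p(i := s))) differentiable (at (p i))"

text \<open>
  \<open>C\<^sup>k\<close> on an open set: all partial derivatives of order at most \<open>k\<close> exist and are continuous.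
\<close>

fun Ck_on :: "nat \<Rightarrow> nat \<Rightarrow> point set \<Rightarrow> (point \<Rightarrow> real) \<Rightarrow> bool" where
  "Ck_on n 0 \<Omega> u \<longleftrightarrow> continuous_map (subtopology (Rn n) \<Omega>) euclideanreal u"
| "Ck_on n (Suc k) \<Omega> u \<longleftrightarrow>
     continuous_map (subtopology (Rn n) \<Omega>) euclideanreal u \<and>
     (\<forall>i<n. (\<forall>p\<in>\<Omega>. has_pderiv_at i u p) \<and> Ck_on n k \<Omega> (pderiv_at i u))"

text \<open>
  \<open>C\<^sub>0\<^sup>\<infinity>(\<Omega>)\<close>, as functions on all of \<open>\<real>\<^sup>n\<close> whose support is compact and contained in \<open>\<Omega>\<close>.
\<close>

definition test_function :: "nat \<Rightarrow> point set \<Rightarrow> (point \<Rightarrow> real) \<Rightarrow> bool" where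
  "test_function n \<Omega> \<phi> \<longleftrightarrow>
     (\<forall>k. Ck_on n k (topspace (Rn n)) \<phi>) \<and>
     (let S = Rn n closure_of {p \<in> topspace (Rn n). \<phi> p \<noteq> 0}
      in compactin (Rn n) S \<and> S \<subseteq> \<Omega>)"

definition grad_sq :: "nat \<Rightarrow> (point \<Rightarrow> real) \<Rightarrow> point \<Rightarrow> real" where
  "grad_sq n u p = (\<Sum>i<n. (pderiv_at i u p)\<^sup>2)"

text \<open>
  Points of the Heisenberg group are pairs \<open>(z, t)\<close> with \<open>z = x + i y\<close>.
\<close>

type_synonym heisenberg = "complex \<times> real"

definition x_coord :: "(point \<Rightarrow> heisenberg) \<Rightarrow> point \<Rightarrow> real" where
  "x_coord f p = Re (fst (f p))"

definition y_coord :: "(point \<Rightarrow> heisenberg) \<Rightarrow> point \<Rightarrow> real" where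
  "y_coord f p = Im (fst (f p))"

definition t_coord :: "(point \<Rightarrow> heisenberg) \<Rightarrow> point \<Rightarrow> real" where
  "t_coord f p = snd (f p)"

definition isotropic :: "nat \<Rightarrow> point set \<Rightarrow> (point \<Rightarrow> heisenberg) \<Rightarrow> bool" where
  "isotropic n \<Omega> f \<longleftrightarrow>
     (\<forall>p\<in>\<Omega>. \<forall>\<alpha> \<beta>. \<alpha> < \<beta> \<and> \<beta> < n \<longrightarrow>
        pderiv_at \<alpha> (x_coord f) p * pderiv_at \<beta> (y_coord f) p
        - pderiv_at \<beta> (x_coord f) p * pderiv_at \<alpha> (y_coord f) p = 0)"

text \<open>
  The condition \<open>f\<^sup>*\<theta> = 0\<close> for the contact form \<open>\<theta> = dt + 2 (x dy - y dx)\<close>.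
\<close>

definition contact :: "nat \<Rightarrow> point set \<Rightarrow> (point \<Rightarrow> heisenberg) \<Rightarrow> bool" where
  "contact n \<Omega> f \<longleftrightarrow>
     (\<forall>p\<in>\<Omega>. \<forall>\<alpha><n.
        pderiv_at \<alpha> (t_coord f) p =
        2 * (y_coord f p * pderiv_at \<alpha> (x_coord f) p - x_coord f p * pderiv_at \<alpha> (y_coord f) p))"

text \<open>
  Criticality of \<open>z\<close> for the energy \<open>\<integral>\<^sub>\<Omega> |\<nabla>z|\<^sup>2 dx\<close> under the domain variations
  \<open>z(x + s \<xi>(x))\<close>, in the form of the first variation formula, tested with the vector fields
  \<open>\<xi> = \<phi> e\<^sub>\<gamma>\<close>.
\<close>

definition energy_critical :: "nat \<Rightarrow> point set \<Rightarrow> (point \<Rightarrow> heisenberg) \<Rightarrow> bool" where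
  "energy_critical n \<Omega> f \<longleftrightarrow>
     (\<forall>\<phi>. test_function n \<Omega> \<phi> \<longrightarrow> (\<forall>\<gamma><n.
        (LINT p:\<Omega>|lebesgue_Rn n.
            (grad_sq n (x_coord f) p + grad_sq n (y_coord f) p) * pderiv_at \<gamma> \<phi> p
            - 2 * (\<Sum>\<beta><n.
                (pderiv_at \<beta> (x_coord f) p * pderiv_at \<gamma> (x_coord f) p
                 + pderiv_at \<beta> (y_coord f) p * pderiv_at \<gamma> (y_coord f) p)
                * pderiv_at \<beta> \<phi> p)) = 0))"

definition harmonic_curve :: "nat \<Rightarrow> point set \<Rightarrow> (point \<Rightarrow> heisenberg) \<Rightarrow> bool" where
  "harmonic_curve n \<Omega> f \<longleftrightarrow>
     Ck_on n 2 \<Omega> (x_coord f) \<and> Ck_on n 2 \<Omega> (y_coord f) \<and> Ck_on n 2 \<Omega> (t_coord f) \<and>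
     isotropic n \<Omega> f \<and> contact n \<Omega> f \<and> energy_critical n \<Omega> f"

text \<open>
  \<open>H\<close> is \<open>C\<^sup>2\<close> on the interval \<open>I\<close> with derivatives \<open>H'\<close> and \<open>H''\<close>. The interval may contain
  its endpoints, where the derivatives are one-sided. It must be nondegenerate, so that \<open>H'\<close> and
  \<open>H''\<close> are determined by \<open>H\<close> on \<open>I\<close>.
\<close>

definition C2_on_interval ::
    "real set \<Rightarrow> (real \<Rightarrow> real) \<Rightarrow> (real \<Rightarrow> real) \<Rightarrow> (real \<Rightarrow> real) \<Rightarrow> bool" where
  "C2_on_interval I H H' H'' \<longleftrightarrow>
     is_interval I \<and> (\<exists>a\<in>I. \<exists>b\<in>I. a < b) \<and>
     (\<forall>s\<in>I. (H has_real_derivative H' s) (at s within I)) \<and>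
     (\<forall>s\<in>I. (H' has_real_derivative H'' s) (at s within I)) \<and>
     continuous_on I H''"

end

theory Submission
  imports Defs
begin

text \<open>
  The stress tensor of \<open>z\<close> is \<open>(1 + H'(y)\<^sup>2) (|\<nabla>y|\<^sup>2 \<delta> - 2 \<nabla>y \<otimes> \<nabla>y)\<close>. Criticality says
  that it is weakly, hence by the fundamental lemma pointwise, divergence free. Its divergence is
  \<open>-2 (1 + H'(y)\<^sup>2) (\<Delta>y + h(y) |\<nabla>y|\<^sup>2) \<nabla>y\<close> with \<open>h = H'' H' / (1 + H'\<^sup>2)\<close>. The scalar factor
  vanishes: on the open set where it does not, \<open>\<nabla>y\<close> and with it \<open>\<Delta>y\<close> would be zero. Testing
  \<open>\<Delta>y = - h(y) |\<nabla>y|\<^sup>2\<close> with \<open>y \<eta>\<^sup>2\<close>, the bound \<open>|h(y) y| \<le> \<mu>\<close> absorbs the right-hand side,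
  and Young's inequality gives \<open>C = 4 / (1 - \<mu>)\<^sup>2\<close>.
\<close>

section \<open>Partial derivatives and \<open>C\<^sup>k\<close> functions\<close>

text \<open>The dimension is a variable of the formula and points are functions, so the calculus is
  reduced to single coordinate lines: partial derivatives are one-variable derivatives, and the
  vanishing of integrated derivatives comes from Fubini and the fundamental theorem of calculus on
  each line. Nothing is known about the boundary of \<Omega>, hence every integrand is given compact
  support inside \<Omega> and is extended by zero. The divergence of the stress tensor contains the
  sum of \<open>D i y\<close> times the mixed second derivatives of \<open>y\<close> twice, once
  from the gradient of |grad y|^2 and once from the divergence of grad y \<otimes> grad y, with the
  order of differentiation exchanged. The two sums cancel only because second derivatives are
  symmetric; this is why the smooth functions used for testing are products over the
  coordinates.\<close>

abbreviation has_partial :: "nat \<Rightarrow> (point \<Rightarrow> real) \<Rightarrow> real \<Rightarrow> point \<Rightarrow> bool" where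
  "has_partial i u d p \<equiv> ((\<lambda>s. u (p(i := s))) has_real_derivative d) (at (p i))"

lemma has_partial_pderiv_at:
  "has_pderiv_at i u p \<Longrightarrow> has_partial i u (pderiv_at i u p) p"
  by (simp add: has_pderiv_at_def pderiv_at_def DERIV_deriv_iff_real_differentiable)

lemma has_partial_imp_has_pderiv_at: "has_partial i u d p \<Longrightarrow> has_pderiv_at i u p"
  by (auto simp: has_pderiv_at_def real_differentiable_def)

lemma has_partial_imp_pderiv_at: "has_partial i u d p \<Longrightarrow> pderiv_at i u p = d"
  by (simp add: pderiv_at_def DERIV_imp_deriv)

lemma topspace_Rn: "topspace (Rn n) = {p. \<forall>i\<ge>n. p i = undefined}"
  by (auto simp: PiE_def extensional_def)

text \<open>The entry \<open>p i\<close> is overwritten along the line, so \<open>p\<close> may be a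
  point in which only the other coordinates have been set. The Fubini argument in
  \<open>integral_partial_eq_0\<close> produces exactly such points.\<close>

lemma continuous_map_line:
  assumes "\<And>j. j \<ge> n \<Longrightarrow> j \<noteq> i \<Longrightarrow> p j = undefined" "i < n"
  shows "continuous_map euclideanreal (Rn n) (\<lambda>s. p(i := s))"
  unfolding continuous_map_componentwise using assms
  by (auto simp: extensional_def fun_upd_def not_less)

lemma open_line:
  assumes "openin (Rn n) \<Omega>" "p \<in> \<Omega>" "i < n"
  shows "open {s. p(i := s) \<in> \<Omega>}"
proof -
  have "p \<in> topspace (Rn n)" using openin_subset[OF assms(1)] assms(2) by (rule subsetD)
  then have "continuous_map euclideanreal (Rn n) (\<lambda>s. p(i := s))"
    using assms(3) by (intro continuous_map_line) (simp_all only: topspace_Rn mem_Collect_eq)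
  from openin_continuous_map_preimage[OF this assms(1)] show ?thesis
    by (simp only: topspace_euclidean UNIV_I simp_thms open_openin)
qed

lemma eventually_line:
  assumes "openin (Rn n) \<Omega>" "p \<in> \<Omega>" "i < n"
  shows "\<forall>\<^sub>F s in nhds (p i). p(i := s) \<in> \<Omega>"
  using eventually_nhds_in_open[OF open_line[OF assms], of "p i"] assms(2) by simp

text \<open>Openness keeps a coordinate line through \<open>p\<close> inside \<Omega> for all
  parameters near \<open>p i\<close>, and a derivative depends only on these.\<close>

lemma has_partial_cong:
  assumes "openin (Rn n) \<Omega>" "p \<in> \<Omega>" "i < n" "\<And>q. q \<in> \<Omega> \<Longrightarrow> u q = v q"
  shows "has_partial i u d p \<longleftrightarrow> has_partial i v d p"
proof (rule DERIV_cong_ev)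
  show "\<forall>\<^sub>F s in nhds (p i). u (p(i := s)) = v (p(i := s))"
    using eventually_line[OF assms(1-3)] by eventually_elim (use assms(4) in auto)
qed auto

lemma pderiv_at_cong:
  assumes "openin (Rn n) \<Omega>" "p \<in> \<Omega>" "i < n" "\<And>q. q \<in> \<Omega> \<Longrightarrow> u q = v q"
  shows "pderiv_at i u p = pderiv_at i v p"
proof -
  have "has_partial i u d p = has_partial i v d p" for d
    by (rule has_partial_cong[OF assms])
  then show ?thesis by (simp add: pderiv_at_def deriv_def)
qed

lemma topspace_open_subtopology: "openin (Rn n) \<Omega> \<Longrightarrow> topspace (subtopology (Rn n) \<Omega>) = \<Omega>"
  using openin_subset by fastforce

lemma continuous_cong_open:
  assumes "openin (Rn n) \<Omega>" "\<And>q. q \<in> \<Omega> \<Longrightarrow> u q = v q"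
    "continuous_map (subtopology (Rn n) \<Omega>) euclideanreal u"
  shows "continuous_map (subtopology (Rn n) \<Omega>) euclideanreal v"
  using continuous_map_eq[OF assms(3)] assms(2) topspace_open_subtopology[OF assms(1)] by simp

lemma Ck_on_cong:
  assumes "openin (Rn n) \<Omega>" "\<And>q. q \<in> \<Omega> \<Longrightarrow> u q = v q" "Ck_on n k \<Omega> u"
  shows "Ck_on n k \<Omega> v"
  using assms(2,3)
proof (induction k arbitrary: u v)
  case 0
  then show ?case using continuous_cong_open[OF assms(1), of u v] by simp
next
  case (Suc k)
  have "has_pderiv_at i v p" if "i < n" "p \<in> \<Omega>" for i p
    using Suc.prems that has_partial_pderiv_at[of i u p]
      has_partial_cong[OF assms(1) that(2,1), of u v]
    by (auto intro: has_partial_imp_has_pderiv_at)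
  moreover have "Ck_on n k \<Omega> (pderiv_at i v)" if "i < n" for i
    using Suc.prems that pderiv_at_cong[OF assms(1) _ that, of _ u v]
    by (intro Suc.IH[of "pderiv_at i u" "pderiv_at i v"]) auto
  ultimately show ?case
    using Suc.prems continuous_cong_open[OF assms(1), of u v] by simp
qed

text \<open>The closure properties below are proved with explicit derivative formulas
  \<open>d\<close>. Such a formula is known to agree with \<open>pderiv_at\<close> on \<Omega> only,
  so its regularity has to be transferred by \<open>Ck_on_cong\<close>.\<close>

lemma Ck_on_SucI:
  assumes "openin (Rn n) \<Omega>" "continuous_map (subtopology (Rn n) \<Omega>) euclideanreal u"
    "\<And>i p. i < n \<Longrightarrow> p \<in> \<Omega> \<Longrightarrow> has_partial i u (d i p) p"
    "\<And>i. i < n \<Longrightarrow> Ck_on n k \<Omega> (d i)"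
  shows "Ck_on n (Suc k) \<Omega> u"
proof -
  have "has_pderiv_at i u p" if "i < n" "p \<in> \<Omega>" for i p
    using assms(3)[OF that] by (rule has_partial_imp_has_pderiv_at)
  moreover have "Ck_on n k \<Omega> (pderiv_at i u)" if "i < n" for i
  proof (rule Ck_on_cong[OF assms(1) _ assms(4)[OF that]])
    show "d i q = pderiv_at i u q" if "q \<in> \<Omega>" for q
      using has_partial_imp_pderiv_at[OF assms(3)[OF \<open>i < n\<close> that]] by simp
  qed
  ultimately show ?thesis using assms(2) by simp
qed

lemma Ck_on_continuous:
  "Ck_on n k \<Omega> u \<Longrightarrow> continuous_map (subtopology (Rn n) \<Omega>) euclideanreal u"
  by (cases k) auto

lemma Ck_on_has_partial:
  "Ck_on n (Suc k) \<Omega> u \<Longrightarrow> i < n \<Longrightarrow> p \<in> \<Omega> \<Longrightarrow> has_partial i u (pderiv_at i u p) p"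
  by (simp add: has_partial_pderiv_at)

lemma Ck_on_pderiv_at: "Ck_on n (Suc k) \<Omega> u \<Longrightarrow> i < n \<Longrightarrow> Ck_on n k \<Omega> (pderiv_at i u)"
  by simp

lemma Ck_on_Suc_imp: "Ck_on n (Suc k) \<Omega> u \<Longrightarrow> Ck_on n k \<Omega> u"
proof (induction k arbitrary: u)
  case (Suc k)
  then show ?case by (metis Ck_on.simps(2))
qed simp

lemma Ck_on_subset:
  assumes "openin (Rn n) U" "openin (Rn n) \<Omega>" "\<Omega> \<subseteq> U" "Ck_on n k U u"
  shows "Ck_on n k \<Omega> u"
  using assms(4)
proof (induction k arbitrary: u)
  case 0
  then show ?case using assms(3) by (auto intro: continuous_map_from_subtopology_mono)
next
  case (Suc k)
  then show ?case using assms(3) by (auto intro: continuous_map_from_subtopology_mono)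
qed

section \<open>Closure properties of the classes C^k\<close>

lemma Ck_on_const:
  assumes "openin (Rn n) \<Omega>"
  shows "Ck_on n k \<Omega> (\<lambda>_. c)"
proof (induction k arbitrary: c)
  case (Suc k)
  show ?case by (rule Ck_on_SucI[OF assms, where d = "\<lambda>_ _. 0"]) (use Suc in auto)
qed simp

lemma Ck_on_add:
  assumes "openin (Rn n) \<Omega>"
  shows "Ck_on n k \<Omega> u \<Longrightarrow> Ck_on n k \<Omega> v \<Longrightarrow> Ck_on n k \<Omega> (\<lambda>p. u p + v p)"
proof (induction k arbitrary: u v)
  case 0
  then show ?case by (auto intro: continuous_map_add)
next
  case (Suc k)
  show ?case
  proof (rule Ck_on_SucI[OF assms, where d = "\<lambda>i p. pderiv_at i u p + pderiv_at i v p"])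
    show "continuous_map (subtopology (Rn n) \<Omega>) euclideanreal (\<lambda>p. u p + v p)"
      using Suc.prems[THEN Ck_on_continuous] by (rule continuous_map_add)
    show "has_partial i (\<lambda>p. u p + v p) (pderiv_at i u p + pderiv_at i v p) p"
      if "i < n" "p \<in> \<Omega>" for i p
      using Suc.prems[THEN Ck_on_has_partial, OF that] by (rule DERIV_add)
    show "Ck_on n k \<Omega> (\<lambda>p. pderiv_at i u p + pderiv_at i v p)" if "i < n" for i
      using Suc.prems[THEN Ck_on_pderiv_at, OF that] by (rule Suc.IH)
  qed
qed

lemma has_partial_mult:
  assumes "has_partial i u d p" "has_partial i v e p"
  shows "has_partial i (\<lambda>q. u q * v q) (d * v p + u p * e) p"
  using DERIV_mult[OF assms] by (simp add: algebra_simps)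

lemma Ck_on_mult:
  assumes "openin (Rn n) \<Omega>"
  shows "Ck_on n k \<Omega> u \<Longrightarrow> Ck_on n k \<Omega> v \<Longrightarrow> Ck_on n k \<Omega> (\<lambda>p. u p * v p)"
proof (induction k arbitrary: u v)
  case 0
  then show ?case by (auto intro: continuous_map_real_mult)
next
  case (Suc k)
  show ?case
  proof (rule Ck_on_SucI[OF assms, where d = "\<lambda>i p. pderiv_at i u p * v p + u p * pderiv_at i v p"])
    show "continuous_map (subtopology (Rn n) \<Omega>) euclideanreal (\<lambda>p. u p * v p)"
      using Suc.prems[THEN Ck_on_continuous] by (rule continuous_map_real_mult)
    show "has_partial i (\<lambda>p. u p * v p) (pderiv_at i u p * v p + u p * pderiv_at i v p) p"
      if "i < n" "p \<in> \<Omega>" for i p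
      using Suc.prems[THEN Ck_on_has_partial, OF that] by (rule has_partial_mult)
    show "Ck_on n k \<Omega> (\<lambda>p. pderiv_at i u p * v p + u p * pderiv_at i v p)" if "i < n" for i
      using Suc.prems[THEN Ck_on_pderiv_at, OF that] Suc.prems[THEN Ck_on_Suc_imp]
      by (intro Ck_on_add[OF assms] Suc.IH)
  qed
qed

lemma Ck_on_power:
  "openin (Rn n) \<Omega> \<Longrightarrow> Ck_on n k \<Omega> u \<Longrightarrow> Ck_on n k \<Omega> (\<lambda>p. u p ^ m)"
  by (induction m) (auto intro: Ck_on_const Ck_on_mult)

lemma Ck_on_sum:
  assumes "openin (Rn n) \<Omega>" "\<And>j. j \<in> J \<Longrightarrow> Ck_on n k \<Omega> (u j)"
  shows "Ck_on n k \<Omega> (\<lambda>p. \<Sum>j\<in>J. u j p)"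
  using assms(2)
  by (induction J rule: infinite_finite_induct) (auto intro: Ck_on_const Ck_on_add assms(1))

lemma Ck_on_prod:
  assumes "openin (Rn n) \<Omega>" "\<And>j. j \<in> J \<Longrightarrow> Ck_on n k \<Omega> (u j)"
  shows "Ck_on n k \<Omega> (\<lambda>p. \<Prod>j\<in>J. u j p)"
  using assms(2)
  by (induction J rule: infinite_finite_induct) (auto intro: Ck_on_const Ck_on_mult assms(1))

text \<open>At an endpoint of \<open>I\<close> the function \<open>g\<close> has only a one-sided
  derivative. The chain rule is therefore applied within the slice of the coordinate line that lies
  in \<Omega>: its image under \<open>u\<close> stays in \<open>I\<close>, and since the slice is
  open the result is an ordinary two-sided partial derivative.\<close>

lemma Ck_on_comp_interval:
  assumes \<Omega>: "openin (Rn n) \<Omega>" and u: "Ck_on n 1 \<Omega> u" "u ` \<Omega> \<subseteq> I"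
    and g: "\<And>s. s \<in> I \<Longrightarrow> (g has_real_derivative g' s) (at s within I)" "continuous_on I g'"
  shows Ck_on_comp_interval_C1: "Ck_on n 1 \<Omega> (\<lambda>p. g (u p))"
    and has_partial_comp_interval:
      "\<And>i p. i < n \<Longrightarrow> p \<in> \<Omega> \<Longrightarrow> has_partial i (\<lambda>p. g (u p)) (g' (u p) * pderiv_at i u p) p"
    and continuous_map_comp_interval:
      "\<And>h. continuous_on I h \<Longrightarrow> continuous_map (subtopology (Rn n) \<Omega>) euclideanreal (\<lambda>p. h (u p))"
proof -
  show comp: "continuous_map (subtopology (Rn n) \<Omega>) euclideanreal (\<lambda>p. h (u p))"
    if "continuous_on I h" for h
  proof -
    have "continuous_map (subtopology (Rn n) \<Omega>) (top_of_set I) u"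
      using Ck_on_continuous[OF u(1)]
    proof (rule continuous_map_into_subtopology)
      show "u \<in> topspace (subtopology (Rn n) \<Omega>) \<rightarrow> I"
        unfolding topspace_open_subtopology[OF \<Omega>] using u(2) by blast
    qed
    moreover have "continuous_map (top_of_set I) euclideanreal h"
      using that by simp
    ultimately show ?thesis
      using continuous_map_compose[of _ _ u _ h] by (simp add: o_def)
  qed
  show part: "has_partial i (\<lambda>p. g (u p)) (g' (u p) * pderiv_at i u p) p"
    if "i < n" "p \<in> \<Omega>" for i p
  proof -
    let ?S = "{s. p(i := s) \<in> \<Omega>}"
    have S: "open ?S" "p i \<in> ?S"
      using open_line[OF \<Omega> that(2,1)] that(2) by (simp_all only: mem_Collect_eq fun_upd_triv)
    have inner: "((\<lambda>s. u (p(i := s))) has_real_derivative pderiv_at i u p) (at (p i) within ?S)"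
      using Ck_on_has_partial[OF u(1)[unfolded One_nat_def] that]
      by (rule has_field_derivative_at_within)
    have outer: "(g has_real_derivative g' (u p)) (at (u (p(i := p i))) within (\<lambda>s. u (p(i := s))) ` ?S)"
    proof (rule DERIV_subset)
      show "(g has_real_derivative g' (u p)) (at (u (p(i := p i))) within I)"
        using g(1)[of "u p"] that(2) u(2) unfolding fun_upd_triv by blast
      show "(\<lambda>s. u (p(i := s))) ` ?S \<subseteq> I" using u(2) by blast
    qed
    show ?thesis
      using DERIV_image_chain[OF outer inner] unfolding at_within_open[OF S(2,1)] o_def .
  qed
  have g_cont: "continuous_on I g"
    using g(1) by (auto intro: DERIV_continuous_on)
  have *: "Ck_on n 0 \<Omega> (pderiv_at i u)" if "i < n" for i using u that by simp
  show "Ck_on n 1 \<Omega> (\<lambda>p. g (u p))"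
    unfolding One_nat_def
  proof (rule Ck_on_SucI[OF \<Omega> comp[OF g_cont] part])
    show "Ck_on n 0 \<Omega> (\<lambda>p. g' (u p) * pderiv_at i u p)" if "i < n" for i
      using comp[OF g(2)] *[OF that] by (intro Ck_on_mult[OF \<Omega>]) auto
  qed
qed

section \<open>Integration of compactly supported functions\<close>

text \<open>On the space of all functions from \<open>nat\<close> to the reals the Borel and product
  sigma-algebras coincide. So \<open>g\<close> is pulled back along the restriction
  \<open>?r\<close> to a continuous, hence Borel, function there, and brought down again along the
  measurable extension by zero \<open>?e\<close>; on points of R^n, \<open>?r\<close> undoes
  \<open>?e\<close>.\<close>

lemma borel_measurable_continuous_Rn:
  assumes "continuous_map (Rn n) euclideanreal g"
  shows "g \<in> borel_measurable (lebesgue_Rn n)"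
proof -
  let ?r = "\<lambda>p :: point. restrict p {..<n}"
  let ?e = "\<lambda>(p :: point) i. if i < n then p i else 0"
  have "continuous_map (powertop_real UNIV) (Rn n) ?r"
    unfolding continuous_map_componentwise
    using continuous_map_product_projection[of _ UNIV "\<lambda>_. euclideanreal"]
    by (auto simp: restrict_def extensional_def)
  then have "continuous_map euclidean euclideanreal (g \<circ> ?r)"
    using assms unfolding euclidean_product_topology by (rule continuous_map_compose)
  then have "g \<circ> ?r \<in> borel_measurable borel"
    by (simp add: borel_measurable_continuous_onI)
  moreover have "?e \<in> measurable (lebesgue_Rn n) (Pi\<^sub>M UNIV (\<lambda>_. borel))"
  proof (rule measurable_PiM_single')
    show "(\<lambda>p. if i < n then p i else 0) \<in> borel_measurable (lebesgue_Rn n)" for i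
      by (cases "i < n") auto
  qed auto
  then have "?e \<in> measurable (lebesgue_Rn n) borel"
    by (simp add: measurable_def sets_PiM_equal_borel space_PiM)
  ultimately have "(g \<circ> ?r) \<circ> ?e \<in> borel_measurable (lebesgue_Rn n)"
    using measurable_comp by blast
  moreover have "((g \<circ> ?r) \<circ> ?e) p = g p" if "p \<in> space (lebesgue_Rn n)" for p
  proof -
    have "?r (?e p) = p" using that by (auto simp: space_PiM PiE_def extensional_def fun_eq_iff)
    then show ?thesis by simp
  qed
  ultimately show ?thesis by (simp cong: measurable_cong)
qed

lemma compactin_Rn_bounded:
  assumes "compactin (Rn n) K"
  obtains B where "B > 0" "\<And>p i. p \<in> K \<Longrightarrow> i < n \<Longrightarrow> \<bar>p i\<bar> \<le> B"
proof -
  have "\<exists>b. \<forall>p\<in>K. \<bar>p i\<bar> \<le> b" if "i < n" for i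
  proof -
    have "compactin euclideanreal ((\<lambda>p. p i) ` K)"
      using assms continuous_map_product_projection[of i "{..<n}" "\<lambda>_. euclideanreal"] that
      by (intro image_compactin[of "Rn n"]) auto
    then have "bounded ((\<lambda>p. p i) ` K)" by (simp add: compact_imp_bounded)
    then show ?thesis by (auto simp: bounded_iff)
  qed
  then obtain b where b: "\<And>i p. i < n \<Longrightarrow> p \<in> K \<Longrightarrow> \<bar>p i\<bar> \<le> b i" by metis
  \<comment> \<open>The sum dominates every single \<open>b i\<close>, and the added 1 makes the
    common bound positive.\<close>
  have "\<bar>p i\<bar> \<le> 1 + (\<Sum>i<n. \<bar>b i\<bar>)" if "p \<in> K" "i < n" for p i
    using b[OF that(2,1)] member_le_sum[of i "{..<n}" "\<lambda>i. \<bar>b i\<bar>"] that by fastforce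
  moreover have "1 + (\<Sum>i<n. \<bar>b i\<bar>) > 0" by (smt (verit) sum_nonneg abs_ge_zero)
  ultimately show thesis using that by blast
qed

text \<open>\<open>K\<close> lies in a cube of finite volume, and \<open>g\<close> is bounded on the
  compact set \<open>K\<close> and zero elsewhere. Working with the cube makes measurability and
  volume immediate.\<close>

lemma integrable_continuous_compact:
  assumes "continuous_map (Rn n) euclideanreal g" "compactin (Rn n) K"
    "\<And>p. p \<in> topspace (Rn n) - K \<Longrightarrow> g p = 0"
  shows "integrable (lebesgue_Rn n) g"
proof -
  interpret product_sigma_finite "\<lambda>_ :: nat. lborel :: real measure" by standard
  obtain B where B: "B > 0" "\<And>p i. p \<in> K \<Longrightarrow> i < n \<Longrightarrow> \<bar>p i\<bar> \<le> B"
    using compactin_Rn_bounded[OF assms(2)] by blast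
  let ?Q = "Pi\<^sub>E {..<n} (\<lambda>_. {-B..B})"
  have "compactin euclideanreal (g ` K)" using assms by (intro image_compactin)
  then have "bounded (g ` K)" by (simp add: compact_imp_bounded)
  then obtain M where M: "\<And>p. p \<in> K \<Longrightarrow> \<bar>g p\<bar> \<le> M" by (auto simp: bounded_iff)
  have KQ: "p \<in> ?Q" if "p \<in> K" for p
    using B(2)[OF that] compactin_subset_topspace[OF assms(2)] that
    by (auto simp: PiE_iff abs_le_iff) (smt (verit))+
  show ?thesis
  \<comment> \<open>The cube also contains points outside \<open>K\<close>, where \<open>g\<close>
    is zero; \<open>max 0 M\<close> covers them even if \<open>K\<close> is empty and
    \<open>M\<close> negative.\<close>
  proof (rule integrableI_bounded_set[where A = ?Q and B = "max 0 M"])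
    show "?Q \<in> sets (lebesgue_Rn n)" by (auto intro!: sets_PiM_I_finite)
    show "g \<in> borel_measurable (lebesgue_Rn n)"
      by (rule borel_measurable_continuous_Rn) fact
    show "emeasure (lebesgue_Rn n) ?Q < \<infinity>"
      using B(1) by (subst emeasure_PiM) (auto simp: ennreal_power)
    show "AE p in lebesgue_Rn n. p \<in> ?Q \<longrightarrow> norm (g p) \<le> max 0 M"
    proof (rule AE_I2)
      fix p assume "p \<in> space (lebesgue_Rn n)"
      then have "p \<in> topspace (Rn n)" by (simp add: space_PiM)
      then show "p \<in> ?Q \<longrightarrow> norm (g p) \<le> max 0 M"
        using M[of p] assms(3)[of p] by (cases "p \<in> K") auto
    qed
    show "AE p in lebesgue_Rn n. p \<notin> ?Q \<longrightarrow> g p = 0"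
    proof (rule AE_I2)
      fix p assume "p \<in> space (lebesgue_Rn n)"
      then have "p \<in> topspace (Rn n)" by (simp add: space_PiM)
      then show "p \<notin> ?Q \<longrightarrow> g p = 0" using KQ[of p] assms(3)[of p] by blast
    qed
  qed
qed

lemma compactin_Rn_imp_closedin: "compactin (Rn n) K \<Longrightarrow> closedin (Rn n) K"
  by (rule compactin_imp_closedin) (simp add: Hausdorff_space_product_topology)

text \<open>Pasting along the open cover by \<Omega> and the complement of \<open>K\<close>, indexed
  by truth values. On the overlap both pieces are zero. The \<open>indicator\<close> form is the one
  under which set integrals unfold.\<close>

lemma continuous_map_zero_extension:
  assumes "openin (Rn n) \<Omega>" "compactin (Rn n) K" "K \<subseteq> \<Omega>"
    "continuous_map (subtopology (Rn n) \<Omega>) euclideanreal w" "\<And>p. p \<in> \<Omega> - K \<Longrightarrow> w p = 0"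
  shows "continuous_map (Rn n) euclideanreal (\<lambda>p. indicator \<Omega> p *\<^sub>R w p)"
proof (rule pasting_lemma[where I = UNIV and T = "\<lambda>b. if b then \<Omega> else topspace (Rn n) - K"
      and f = "\<lambda>b. if b then w else (\<lambda>_. 0)"])
  show "openin (Rn n) (if b then \<Omega> else topspace (Rn n) - K)" for b
    using assms(1) compactin_Rn_imp_closedin[OF assms(2)] by (auto simp only: split: if_splits)
  show "continuous_map (subtopology (Rn n) (if b then \<Omega> else topspace (Rn n) - K)) euclideanreal
      (if b then w else (\<lambda>_. 0))" for b
    using assms(4) by (cases b) auto
  show "(if b then w else (\<lambda>_. 0)) p = (if c then w else (\<lambda>_. 0)) p"
    if "p \<in> topspace (Rn n) \<inter> (if b then \<Omega> else topspace (Rn n) - K)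
      \<inter> (if c then \<Omega> else topspace (Rn n) - K)" for b c p
    using that assms(5)[of p] by (cases b; cases c) auto
  show "\<exists>b. b \<in> UNIV \<and> p \<in> (if b then \<Omega> else topspace (Rn n) - K)
      \<and> indicator \<Omega> p *\<^sub>R w p = (if b then w else (\<lambda>_. 0)) p"
    if "p \<in> topspace (Rn n)" for p
    using that assms(3) by (intro exI[of _ "p \<in> \<Omega>"]) (auto simp: indicator_def)
qed

lemma set_integrable_compact_support:
  assumes "openin (Rn n) \<Omega>" "compactin (Rn n) K" "K \<subseteq> \<Omega>"
    "continuous_map (subtopology (Rn n) \<Omega>) euclideanreal w" "\<And>p. p \<in> \<Omega> - K \<Longrightarrow> w p = 0"
  shows "set_integrable (lebesgue_Rn n) \<Omega> w"
  unfolding set_integrable_def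
proof (rule integrable_continuous_compact[OF continuous_map_zero_extension[OF assms] assms(2)])
  show "indicator \<Omega> p *\<^sub>R w p = 0" if "p \<in> topspace (Rn n) - K" for p
    using that assms(5)[of p] by (cases "p \<in> \<Omega>") auto
qed

section \<open>Derivatives of compactly supported functions integrate to zero\<close>

lemma pderiv_at_vanishes:
  assumes "openin (Rn n) \<Omega>" "compactin (Rn n) K" "\<And>p. p \<in> \<Omega> - K \<Longrightarrow> u p = 0"
    "p \<in> \<Omega> - K" "i < n"
  shows "pderiv_at i u p = 0"
proof -
  have "openin (Rn n) (\<Omega> - K)"
    using assms(1) compactin_Rn_imp_closedin[OF assms(2)] by (rule openin_diff)
  then have "pderiv_at i u p = pderiv_at i (\<lambda>_. 0) p"
    using assms(4,5,3) by (rule pderiv_at_cong)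
  then show ?thesis by (simp add: pderiv_at_def)
qed

text \<open>By Fubini the coordinate \<open>i\<close> may be integrated innermost. On each line
  parallel to that axis the fundamental theorem of calculus gives a difference of values of
  \<open>F\<close> beyond its support.\<close>

lemma integral_partial_eq_0:
  assumes i: "i < n" and d: "continuous_map (Rn n) euclideanreal d"
    and F: "\<And>p. p \<in> topspace (Rn n) \<Longrightarrow> has_partial i F (d p) p"
    and K: "compactin (Rn n) K" "\<And>p. p \<in> topspace (Rn n) - K \<Longrightarrow> F p = 0"
  shows "(LINT p|lebesgue_Rn n. d p) = 0"
proof -
  interpret product_sigma_finite "\<lambda>_ :: nat. lborel :: real measure" by standard
  have d0: "d p = 0" if "p \<in> topspace (Rn n) - K" for p
    using pderiv_at_vanishes[OF openin_topspace K(1) K(2) that i]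
      has_partial_imp_pderiv_at[OF F[of p]] that by simp
  obtain B where B: "B > 0" "\<And>p i. p \<in> K \<Longrightarrow> i < n \<Longrightarrow> \<bar>p i\<bar> \<le> B"
    using compactin_Rn_bounded[OF K(1)] by blast
  define J where "J = {..<n} - {i}"
  have J: "{..<n} = insert i J" "finite J" "i \<notin> J" using i by (auto simp: J_def)
  have "(LINT p|lebesgue_Rn n. d p)
      = (LINT x|Pi\<^sub>M J (\<lambda>_. lborel). LINT s|lborel. d (x(i := s)))"
    unfolding J(1) using integrable_continuous_compact[OF d K(1) d0] J(2,3)
    by (intro product_integral_insert) (simp_all add: J(1))
  also have "\<dots> = (LINT x|Pi\<^sub>M J (\<lambda>_. (lborel :: real measure)). 0)"
  proof (rule Bochner_Integration.integral_cong[OF refl])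
    fix x assume "x \<in> space (Pi\<^sub>M J (\<lambda>_. (lborel :: real measure)))"
    then have x: "x j = undefined" if "j \<notin> J" for j
      using that by (auto simp: space_PiM PiE_def extensional_def)
    have top: "x(i := s) \<in> topspace (Rn n)" for s
      unfolding topspace_Rn using x i by (auto simp: J_def)
    have out: "x(i := s) \<in> topspace (Rn n) - K" if "\<bar>s\<bar> > B" for s
      using B(2)[of "x(i := s)" i] i that top[of s] by fastforce
    have cont: "continuous_map euclideanreal euclideanreal (d \<circ> (\<lambda>s. x(i := s)))"
      by (rule continuous_map_compose[OF continuous_map_line d]) (use x i in \<open>auto simp: J_def\<close>)
    \<comment> \<open>The margin 1 puts both endpoints strictly beyond the bound \<open>B\<close>,
      hence outside \<open>K\<close>, where \<open>F\<close> is zero.\<close>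
    have "(LINT s|lborel. d (x(i := s)))
        = (LINT s|lborel. d (x(i := s)) * indicator {-B - 1..B + 1} s)"
    proof (rule Bochner_Integration.integral_cong[OF refl])
      show "d (x(i := s)) = d (x(i := s)) * indicator {-B - 1..B + 1} s" for s
        using d0[OF out[of s]] by (cases "\<bar>s\<bar> > B") (auto simp: indicator_def)
    qed
    also have "\<dots> = F (x(i := B + 1)) - F (x(i := -B - 1))"
    proof (rule integral_FTC_Icc_real)
      show "-B - 1 \<le> B + 1" using B(1) by simp
      show "DERIV (\<lambda>s. F (x(i := s))) s :> d (x(i := s))" for s
        using F[OF top[of s]] by simp
      show "isCont (\<lambda>s. d (x(i := s))) s" for s
        using cont by (simp add: o_def continuous_on_eq_continuous_at)
    qed
    also have "\<dots> = 0"
      using K(2)[OF out[of "B + 1"]] K(2)[OF out[of "-B - 1"]] B(1) by simp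
    finally show "(LINT s|lborel. d (x(i := s))) = 0" .
  qed
  finally show ?thesis by simp
qed

text \<open>The zero extension of \<open>F\<close> is differentiable along \<open>i\<close> at every
  point of R^n, because each point lies in \<Omega> or in the open complement of \<open>K\<close>.
  This reduces the claim to the whole space, whatever the boundary of \<Omega> looks like.\<close>

lemma set_integral_pderiv_eq_0:
  assumes \<Omega>: "openin (Rn n) \<Omega>" and i: "i < n" and F: "Ck_on n 1 \<Omega> F"
    and K: "compactin (Rn n) K" "K \<subseteq> \<Omega>" "\<And>p. p \<in> \<Omega> - K \<Longrightarrow> F p = 0"
  shows set_integrable_pderiv: "set_integrable (lebesgue_Rn n) \<Omega> (pderiv_at i F)"
    and "(LINT p:\<Omega>|lebesgue_Rn n. pderiv_at i F p) = 0"
proof -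
  have d: "continuous_map (subtopology (Rn n) \<Omega>) euclideanreal (pderiv_at i F)"
    using F i by simp
  note d0 = pderiv_at_vanishes[OF \<Omega> K(1,3) _ i]
  show "set_integrable (lebesgue_Rn n) \<Omega> (pderiv_at i F)"
    by (rule set_integrable_compact_support[OF \<Omega> K(1,2) d d0])
  let ?F = "\<lambda>p. indicator \<Omega> p *\<^sub>R F p"
  have out: "?F p = 0" if "p \<in> topspace (Rn n) - K" for p
    using that K(3)[of p] by (cases "p \<in> \<Omega>") auto
  have part: "has_partial i ?F (indicator \<Omega> p *\<^sub>R pderiv_at i F p) p"
    if top: "p \<in> topspace (Rn n)" for p
  proof (cases "p \<in> \<Omega>")
    case True
    have "has_partial i F (pderiv_at i F p) p"
      using Ck_on_has_partial[of n 0 \<Omega> F] F i True by simp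
    then have "has_partial i ?F (pderiv_at i F p) p"
      using has_partial_cong[OF \<Omega> True i, of F ?F] by simp
    then show ?thesis using True by simp
  next
    case False
    have "p \<in> topspace (Rn n) - K" using top False K(2) by blast
    moreover have "openin (Rn n) (topspace (Rn n) - K)"
      using compactin_Rn_imp_closedin[OF K(1)] by blast
    ultimately have "has_partial i ?F 0 p = has_partial i (\<lambda>_. 0) 0 p"
      using i out by (intro has_partial_cong)
    then have "has_partial i ?F 0 p" by simp
    then show ?thesis using False by simp
  qed
  show "(LINT p:\<Omega>|lebesgue_Rn n. pderiv_at i F p) = 0"
    unfolding set_lebesgue_integral_def
    using i continuous_map_zero_extension[OF \<Omega> K(1,2) d d0] part K(1) out
    by (rule integral_partial_eq_0)
qed

section \<open>Smooth bump functions and the fundamental lemma\<close>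

text \<open>\<open>flat 1\<close> is the classical smooth function exp(-1/x), extended by zero to x
  \<le> 0. The polynomial in 1/x makes the family closed under differentiation.\<close>

definition flat :: "real poly \<Rightarrow> real \<Rightarrow> real" where
  "flat P x = (if x > 0 then poly P (inverse x) * exp (- inverse x) else 0)"

text \<open>With u = 1/x, the derivative of P(u) exp(-u) in u is (P' - P)(u) exp(-u), and du/dx =
  -u^2; the factor \<open>[:0, 0, 1:]\<close> is u^2.\<close>

definition flat_deriv_poly :: "real poly \<Rightarrow> real poly" where
  "flat_deriv_poly P = [:0, 0, 1:] * (P - pderiv P)"

lemma tendsto_poly_mult_exp_minus: "((\<lambda>u. poly P u * exp (- u)) \<longlongrightarrow> (0::real)) at_top"
proof -
  have "((\<lambda>u. \<Sum>k\<le>degree P. coeff P k * (u ^ k / exp u)) \<longlongrightarrow> (\<Sum>k\<le>degree P. coeff P k * 0)) at_top"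
    by (intro tendsto_sum tendsto_mult tendsto_const tendsto_power_div_exp_0)
  then show ?thesis
    by (simp add: poly_altdef sum_distrib_right exp_minus divide_inverse mult.assoc)
qed

lemma DERIV_flat: "(flat P has_real_derivative flat (flat_deriv_poly P) x) (at x)"
proof (cases x "0 :: real" rule: linorder_cases)
  case less
  have "((\<lambda>_. 0) has_real_derivative 0) (at x)" by simp
  then have "(flat P has_real_derivative 0) (at x)"
    by (rule has_field_derivative_transform_within_open[where S = "{..<0}"])
      (use less in \<open>auto simp: flat_def\<close>)
  then show ?thesis using less by (simp add: flat_def)
next
  case greater
  have "((\<lambda>x. poly P (inverse x) * exp (- inverse x)) has_real_derivative
      poly (flat_deriv_poly P) (inverse x) * exp (- inverse x)) (at x)"
    using greater unfolding flat_deriv_poly_def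
    by (auto intro!: derivative_eq_intros poly_DERIV[THEN DERIV_chain2]
        simp: algebra_simps power2_eq_square)
  then have "(flat P has_real_derivative
      poly (flat_deriv_poly P) (inverse x) * exp (- inverse x)) (at x)"
    by (rule has_field_derivative_transform_within_open[where S = "{0<..}"])
      (use greater in \<open>auto simp: flat_def\<close>)
  then show ?thesis using greater by (simp add: flat_def)
next
  case equal
  have right: "((\<lambda>h. flat P h / h) \<longlongrightarrow> 0) (at_right 0)"
  proof (rule Lim_transform_eventually)
    \<comment> \<open>With u = 1/h the difference quotient is u P(u) exp(-u), again a polynomial
      against a decaying exponential.\<close>
    show "((\<lambda>h. poly ([:0, 1:] * P) (inverse h) * exp (- inverse h)) \<longlongrightarrow> 0) (at_right 0)"
      using tendsto_poly_mult_exp_minus filterlim_inverse_at_top_right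
      by (rule filterlim_compose)
    show "\<forall>\<^sub>F h in at_right 0. poly ([:0, 1:] * P) (inverse h) * exp (- inverse h) = flat P h / h"
      using eventually_at_right_less[of "0 :: real"]
      by eventually_elim (simp add: flat_def divide_inverse)
  qed
  have left: "((\<lambda>h. flat P h / h) \<longlongrightarrow> 0) (at_left 0)"
  proof (rule tendsto_eventually)
    have "\<forall>\<^sub>F h in at_left 0. h \<in> {- 1<..<0 :: real}"
      by (rule eventually_at_left_real) simp
    then show "\<forall>\<^sub>F h in at_left 0. flat P h / h = 0"
      by eventually_elim (simp add: flat_def)
  qed
  have "((\<lambda>h. flat P h / h) \<longlongrightarrow> 0) (at 0)"
    using left right by (rule filterlim_split_at)
  then show ?thesis using equal by (simp add: DERIV_def flat_def)
qed

lemmas DERIV_flat_chain [derivative_intros] = DERIV_chain2[OF DERIV_flat]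

lemma flat_one_nonneg: "flat 1 x \<ge> 0" and flat_one_pos_iff: "flat 1 x > 0 \<longleftrightarrow> x > 0"
  by (simp_all add: flat_def)

lemma continuous_flat: "continuous_on UNIV (flat P)"
  by (intro continuous_at_imp_continuous_on ballI DERIV_isCont[OF DERIV_flat])

text \<open>A derivative has the same form up to a constant factor, with
  \<open>flat_deriv_poly P\<close> in place of \<open>P\<close>, so the induction on
  \<open>k\<close> runs with \<open>P\<close> generalized. The slopes 1 and -1 serve the left and
  right ends of an interval.\<close>

lemma Ck_on_flat_coordinate:
  assumes "j < n"
  shows "Ck_on n k (topspace (Rn n)) (\<lambda>p. flat P (c * p j + e))"
proof -
  have cont: "continuous_map (subtopology (Rn n) (topspace (Rn n))) euclideanreal
      (\<lambda>p. flat P (c * p j + e))" for P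
  proof -
    have "continuous_map (Rn n) euclideanreal (\<lambda>p. p j)"
      using continuous_map_product_projection[of j "{..<n}" "\<lambda>_. euclideanreal"] assms by simp
    moreover have "continuous_map euclideanreal euclideanreal (\<lambda>s. flat P (c * s + e))"
      by (auto intro!: continuous_intros continuous_on_compose2[OF continuous_flat])
    ultimately show ?thesis
      using continuous_map_compose[of _ _ "\<lambda>p. p j" _ "\<lambda>s. flat P (c * s + e)"]
      unfolding subtopology_topspace o_def by blast
  qed
  show ?thesis
  proof (induction k arbitrary: P)
    case 0
    show ?case using cont by simp
  next
    case (Suc k)
    show ?case
    proof (rule Ck_on_SucI[OF openin_topspace cont,
          where d = "\<lambda>i p. (if i = j then c else 0) * flat (flat_deriv_poly P) (c * p j + e)"])
      show "has_partial i (\<lambda>p. flat P (c * p j + e))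
          ((if i = j then c else 0) * flat (flat_deriv_poly P) (c * p j + e)) p" for i p
        by (auto intro!: derivative_eq_intros)
      show "Ck_on n k (topspace (Rn n))
          (\<lambda>p. (if i = j then c else 0) * flat (flat_deriv_poly P) (c * p j + e))" for i
        by (intro Ck_on_mult[OF openin_topspace] Ck_on_const[OF openin_topspace] Suc.IH)
    qed
  qed
qed

text \<open>The factors are kept as a family \<open>g\<close> so that a partial derivative becomes
  an update of this family at one index.\<close>

definition coord_prod :: "nat \<Rightarrow> (nat \<Rightarrow> real \<Rightarrow> real) \<Rightarrow> point \<Rightarrow> real" where
  "coord_prod n g p = (\<Prod>j<n. g j (p j))"

lemma has_partial_coord_prod:
  assumes "i < n" "(g i has_real_derivative g' (p i)) (at (p i))"
  shows "has_partial i (coord_prod n g) (coord_prod n (g(i := g')) p) p"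
proof -
  have split: "coord_prod n h q = h i (q i) * (\<Prod>j\<in>{..<n} - {i}. h j (q j))" for h q
    unfolding coord_prod_def using assms(1) by (subst prod.remove[of _ i]) auto
  have "(\<Prod>j\<in>{..<n} - {i}. g j ((p(i := s)) j)) = (\<Prod>j\<in>{..<n} - {i}. g j (p j))" for s
    by (rule prod.cong) auto
  moreover have "(\<Prod>j\<in>{..<n} - {i}. (g(i := g')) j (p j)) = (\<Prod>j\<in>{..<n} - {i}. g j (p j))"
    by (rule prod.cong) auto
  ultimately show ?thesis
    unfolding split using assms(2) by (auto intro!: derivative_eq_intros)
qed

text \<open>Derivatives in two different directions are updates of the family at two different
  indices, and these commute. Each factor is then differentiated at most once, so first-order
  differentiability of the factors suffices.\<close>

lemma pderiv_at_coord_prod_commute: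
  assumes "i < n" "j < n" "\<And>k s. k < n \<Longrightarrow> g k differentiable (at s)"
  shows "pderiv_at i (pderiv_at j (coord_prod n g)) = pderiv_at j (pderiv_at i (coord_prod n g))"
proof (cases "i = j")
  case False
  have *: "pderiv_at k (coord_prod n h) = coord_prod n (h(k := deriv (h k)))"
    if "k < n" "\<And>s. h k differentiable (at s)" for k h
  proof
    fix p
    have "(h k has_real_derivative deriv (h k) (p k)) (at (p k))"
      using that(2) by (simp add: DERIV_deriv_iff_real_differentiable)
    with that(1) have "has_partial k (coord_prod n h) (coord_prod n (h(k := deriv (h k))) p) p"
      by (rule has_partial_coord_prod)
    then show "pderiv_at k (coord_prod n h) p = coord_prod n (h(k := deriv (h k))) p"
      by (rule has_partial_imp_pderiv_at)
  qed
  have **: "pderiv_at k (pderiv_at l (coord_prod n g))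
      = coord_prod n (g(l := deriv (g l), k := deriv (g k)))" if "k < n" "l < n" "k \<noteq> l" for k l
    using *[of l g] *[of k "g(l := deriv (g l))"] that assms(3) by simp
  show ?thesis
    unfolding **[OF assms(1,2) False] **[OF assms(2,1) False[symmetric]]
    using fun_upd_twist[OF False] by metis
qed simp

text \<open>Boxes fit both demands on the test functions: their product form makes mixed partials
  commute, and they shrink to points in the product topology.\<close>

definition box_bump :: "nat \<Rightarrow> point \<Rightarrow> point \<Rightarrow> point \<Rightarrow> real" where
  "box_bump n a b = coord_prod n (\<lambda>j s. flat 1 (s - a j) * flat 1 (b j - s))"

lemma pderiv_at_box_bump_commute:
  assumes "i < n" "j < n"
  shows "pderiv_at i (pderiv_at j (box_bump n a b)) = pderiv_at j (pderiv_at i (box_bump n a b))"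
  unfolding box_bump_def
proof (rule pderiv_at_coord_prod_commute[OF assms])
  fix k s
  have "((\<lambda>s. flat 1 (s - a k) * flat 1 (b k - s)) has_real_derivative
      flat (flat_deriv_poly 1) (s - a k) * flat 1 (b k - s)
      - flat 1 (s - a k) * flat (flat_deriv_poly 1) (b k - s)) (at s)"
    by (auto intro!: derivative_eq_intros)
  then show "(\<lambda>s. flat 1 (s - a k) * flat 1 (b k - s)) differentiable (at s)"
    by (auto simp: real_differentiable_def)
qed

lemma Ck_on_box_bump: "Ck_on n k (topspace (Rn n)) (box_bump n a b)"
proof -
  have "Ck_on n k (topspace (Rn n)) (\<lambda>p. flat 1 (p j - a j) * flat 1 (b j - p j))" if "j < n" for j
    using Ck_on_flat_coordinate[OF that, of k 1 1 "- a j"]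
      Ck_on_flat_coordinate[OF that, of k 1 "-1" "b j"]
    by (intro Ck_on_mult[OF openin_topspace]) (simp_all add: algebra_simps)
  then show ?thesis
    unfolding box_bump_def coord_prod_def
    by (intro Ck_on_prod[OF openin_topspace]) simp
qed

lemma box_bump_nonneg: "box_bump n a b p \<ge> 0"
  by (auto simp: box_bump_def coord_prod_def intro!: prod_nonneg mult_nonneg_nonneg flat_one_nonneg)

lemma box_bump_pos: "(\<And>i. i < n \<Longrightarrow> a i < p i \<and> p i < b i) \<Longrightarrow> box_bump n a b p > 0"
  by (auto simp: box_bump_def coord_prod_def flat_one_pos_iff intro!: prod_pos mult_pos_pos)

lemma box_bump_eq_0:
  assumes "p \<in> topspace (Rn n)" "p \<notin> Pi\<^sub>E {..<n} (\<lambda>i. {a i..b i})"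
  shows "box_bump n a b p = 0"
proof -
  obtain i where "i < n" "p i \<notin> {a i..b i}" using assms by (auto simp: PiE_iff)
  then have "flat 1 (p i - a i) * flat 1 (b i - p i) = 0" by (auto simp: flat_def)
  then show ?thesis
    unfolding box_bump_def coord_prod_def using \<open>i < n\<close> by (intro prod_zero) auto
qed

lemma compactin_box: "compactin (Rn n) (Pi\<^sub>E {..<n} (\<lambda>i. {a i..b i}))"
  by (simp add: compactin_PiE)

lemma test_function_box_bump:
  assumes "Pi\<^sub>E {..<n} (\<lambda>i. {a i..b i}) \<subseteq> \<Omega>"
  shows "test_function n \<Omega> (box_bump n a b)"
proof -
  let ?Q = "Pi\<^sub>E {..<n} (\<lambda>i. {a i..b i})"
  let ?S = "Rn n closure_of {p \<in> topspace (Rn n). box_bump n a b p \<noteq> 0}"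
  have "{p \<in> topspace (Rn n). box_bump n a b p \<noteq> 0} \<subseteq> ?Q"
    using box_bump_eq_0 by blast
  then have "?S \<subseteq> ?Q"
    using compactin_Rn_imp_closedin[OF compactin_box] by (rule closure_of_minimal)
  moreover from this have "compactin (Rn n) ?S"
    by (rule closed_compactin[OF compactin_box _ closedin_closure_of])
  ultimately show ?thesis
    using assms Ck_on_box_bump unfolding test_function_def Let_def by blast
qed

section \<open>The fundamental lemma of the calculus of variations\<close>

lemma open_contains_box:
  assumes "openin (Rn n) U" "p \<in> U"
  obtains a b where "\<And>i. i < n \<Longrightarrow> a i < p i \<and> p i < b i" "Pi\<^sub>E {..<n} (\<lambda>i. {a i..b i}) \<subseteq> U"
proof -
  obtain V where V': "\<forall>i\<in>{..<n}. openin euclideanreal (V i)"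
    and V: "p \<in> Pi\<^sub>E {..<n} V" "Pi\<^sub>E {..<n} V \<subseteq> U"
    using assms unfolding openin_product_topology_alt by meson
  have "\<exists>e>0. {p i - e..p i + e} \<subseteq> V i" if "i < n" for i
  proof -
    have "p i \<in> V i" using V(1) that by auto
    moreover have "open (V i)" using V' that by simp
    ultimately obtain e where "e > 0" "cball (p i) e \<subseteq> V i"
      unfolding open_contains_cball by blast
    then show ?thesis by (auto simp: cball_eq_atLeastAtMost)
  qed
  then obtain e where e: "\<And>i. i < n \<Longrightarrow> e i > 0 \<and> {p i - e i..p i + e i} \<subseteq> V i" by metis
  then have "Pi\<^sub>E {..<n} (\<lambda>i. {p i - e i..p i + e i}) \<subseteq> Pi\<^sub>E {..<n} V"
    by (intro PiE_mono) auto
  then show thesis using that[of "\<lambda>i. p i - e i" "\<lambda>i. p i + e i"] e V(2) by simp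
qed

text \<open>By continuity \<open>g\<close> is positive on a whole closed box around
  \<open>p\<close>. The bump of that box makes the integrand nonnegative everywhere and positive on
  the open box, which has positive measure.\<close>

lemma set_integral_box_bump_pos_point:
  assumes \<Omega>: "openin (Rn n) \<Omega>" and g: "continuous_map (subtopology (Rn n) \<Omega>) euclideanreal g"
    and p: "p \<in> \<Omega>" "g p > 0"
  obtains a b where "test_function n \<Omega> (box_bump n a b)"
    "(LINT q:\<Omega>|lebesgue_Rn n. g q * box_bump n a b q) \<noteq> 0"
proof -
  interpret product_sigma_finite "\<lambda>_ :: nat. lborel :: real measure" by standard
  have "openin (subtopology (Rn n) \<Omega>) {q \<in> topspace (subtopology (Rn n) \<Omega>). g q \<in> {0<..}}"
    using g by (rule openin_continuous_map_preimage) auto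
  then have W: "openin (Rn n) {q \<in> \<Omega>. g q > 0}"
    unfolding topspace_open_subtopology[OF \<Omega>] using openin_trans_full[OF _ \<Omega>] by simp
  obtain a b where ab: "\<And>i. i < n \<Longrightarrow> a i < p i \<and> p i < b i"
    and QW: "Pi\<^sub>E {..<n} (\<lambda>i. {a i..b i}) \<subseteq> {q \<in> \<Omega>. g q > 0}"
    using open_contains_box[OF W, of p] p by auto
  let ?Q = "Pi\<^sub>E {..<n} (\<lambda>i. {a i..b i})" and ?O = "Pi\<^sub>E {..<n} (\<lambda>i. {a i<..<b i})"
  let ?f = "\<lambda>q. indicator \<Omega> q *\<^sub>R (g q * box_bump n a b q)"
  have Q\<Omega>: "?Q \<subseteq> \<Omega>" using QW by blast
  have out: "box_bump n a b q = 0" if "q \<in> \<Omega> - ?Q" for q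
    using box_bump_eq_0[of q n a b] that openin_subset[OF \<Omega>] by blast
  have "Ck_on n 0 \<Omega> (box_bump n a b)"
    using Ck_on_subset[OF openin_topspace \<Omega> openin_subset[OF \<Omega>] Ck_on_box_bump] .
  then have "set_integrable (lebesgue_Rn n) \<Omega> (\<lambda>q. g q * box_bump n a b q)"
    using g out
    by (intro set_integrable_compact_support[OF \<Omega> compactin_box Q\<Omega>] continuous_map_real_mult) auto
  then have int: "integrable (lebesgue_Rn n) ?f"
    unfolding set_integrable_def .
  have nonneg: "?f q \<ge> 0" for q
  proof (cases "q \<in> ?Q")
    case True
    then have "g q > 0" using QW by blast
    then show ?thesis using box_bump_nonneg[of n a b q] by simp
  next
    case False
    then show ?thesis using out[of q] by (cases "q \<in> \<Omega>") auto
  qed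
  have pos: "?f q \<noteq> 0" if "q \<in> ?O" for q
  proof -
    have "q \<in> ?Q" using that by (auto simp: PiE_iff less_imp_le)
    then have "q \<in> \<Omega>" "g q > 0" using QW by blast+
    moreover have "box_bump n a b q > 0" using that by (intro box_bump_pos) (auto simp: PiE_iff)
    ultimately show ?thesis by simp
  qed
  have O: "?O \<in> sets (lebesgue_Rn n)" by (auto intro!: sets_PiM_I_finite)
  have ab_less: "a i < b i" if "i < n" for i using ab[OF that] by linarith
  have "emeasure (lebesgue_Rn n) ?O = (\<Prod>i<n. emeasure lborel {a i<..<b i})"
    by (rule emeasure_PiM) auto
  also have "\<dots> = (\<Prod>i<n. ennreal (b i - a i))"
    using ab_less by (intro prod.cong refl emeasure_lborel_Ioo) (simp add: less_imp_le)
  also have "\<dots> \<noteq> 0" using ab_less by (auto simp: ennreal_eq_0_iff not_le)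
  finally have O_pos: "?O \<notin> null_sets (lebesgue_Rn n)" by (auto simp: null_sets_def)
  have "integral\<^sup>L (lebesgue_Rn n) ?f \<noteq> 0"
  proof
    assume "integral\<^sup>L (lebesgue_Rn n) ?f = 0"
    then have "AE q in lebesgue_Rn n. ?f q = 0"
      using integral_nonneg_eq_0_iff_AE[OF int] nonneg by simp
    then have "AE q in lebesgue_Rn n. q \<notin> ?O" by eventually_elim (use pos in blast)
    then show False using AE_iff_null_sets[OF O] O_pos by simp
  qed
  then show thesis
    using that[OF test_function_box_bump[OF Q\<Omega>]] unfolding set_lebesgue_integral_def by blast
qed

text \<open>Applying the previous lemma to \<open>g\<close> or to \<open>- g\<close> excludes both
  signs. The hypothesis asks for box bumps only, so that in \<open>pderiv_at_commute\<close> the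
  symmetry of the test function's own second derivatives is already available.\<close>

lemma fundamental_lemma:
  assumes \<Omega>: "openin (Rn n) \<Omega>" and g: "continuous_map (subtopology (Rn n) \<Omega>) euclideanreal g"
    and zero: "\<And>a b. test_function n \<Omega> (box_bump n a b) \<Longrightarrow>
      (LINT q:\<Omega>|lebesgue_Rn n. g q * box_bump n a b q) = 0"
    and p: "p \<in> \<Omega>"
  shows "g p = 0"
proof (rule ccontr)
  assume "g p \<noteq> 0"
  then consider "g p > 0" | "- g p > 0" by linarith
  then show False
  proof cases
    case 1
    then show False
      using set_integral_box_bump_pos_point[OF \<Omega> g p] zero by blast
  next
    case 2
    have "continuous_map (subtopology (Rn n) \<Omega>) euclideanreal (\<lambda>q. - g q)"
      using g by simp
    then obtain a b where "test_function n \<Omega> (box_bump n a b)"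
      "(LINT q:\<Omega>|lebesgue_Rn n. - g q * box_bump n a b q) \<noteq> 0"
      using set_integral_box_bump_pos_point[OF \<Omega> _ p] 2 by blast
    then show False using zero[of a b] by (simp add: set_lebesgue_integral_def)
  qed
qed

section \<open>Integration by parts and symmetry of second derivatives\<close>

lemma set_integral_cong_on:
  assumes "\<And>p. p \<in> A \<Longrightarrow> f p = g p"
  shows "(LINT p:A|M. f p) = (LINT p:A|M. g p)"
  unfolding set_lebesgue_integral_def
  by (rule Bochner_Integration.integral_cong) (auto simp: assms split: split_indicator)

lemma set_integral_sum_on:
  fixes f :: "'i \<Rightarrow> 'a \<Rightarrow> real"
  assumes "\<And>i. i \<in> J \<Longrightarrow> set_integrable M A (f i)"
  shows "(LINT p:A|M. \<Sum>i\<in>J. f i p) = (\<Sum>i\<in>J. LINT p:A|M. f i p)"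
  using assms unfolding set_lebesgue_integral_def set_integrable_def scaleR_sum_right
  by (rule Bochner_Integration.integral_sum)

lemma test_functionE:
  assumes "test_function n \<Omega> \<phi>" "openin (Rn n) \<Omega>"
  obtains K where "compactin (Rn n) K" "K \<subseteq> \<Omega>" "\<And>p. p \<in> \<Omega> - K \<Longrightarrow> \<phi> p = 0"
    "\<And>k. Ck_on n k \<Omega> \<phi>"
proof
  let ?N = "{p \<in> topspace (Rn n). \<phi> p \<noteq> 0}"
  show "compactin (Rn n) (Rn n closure_of ?N)" "Rn n closure_of ?N \<subseteq> \<Omega>"
    using assms(1) unfolding test_function_def Let_def by blast+
  have "?N \<subseteq> Rn n closure_of ?N" by (rule closure_of_subset) blast
  then show "\<phi> p = 0" if "p \<in> \<Omega> - Rn n closure_of ?N" for p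
    using that openin_subset[OF assms(2)] by blast
  have "Ck_on n k (topspace (Rn n)) \<phi>" for k
    using assms(1) unfolding test_function_def by blast
  then show "Ck_on n k \<Omega> \<phi>" for k
    by (rule Ck_on_subset[OF openin_topspace assms(2) openin_subset[OF assms(2)]])
qed

lemma pderiv_at_mult:
  assumes "Ck_on n 1 \<Omega> u" "Ck_on n 1 \<Omega> v" "i < n" "p \<in> \<Omega>"
  shows "pderiv_at i (\<lambda>q. u q * v q) p = pderiv_at i u p * v p + u p * pderiv_at i v p"
  using assms(1,2)[unfolded One_nat_def, THEN Ck_on_has_partial, OF assms(3,4)]
  by (rule has_partial_imp_pderiv_at[OF has_partial_mult])

text \<open>The product \<open>u v\<close> inherits compact support from \<open>v\<close> alone, so
  its derivative integrates to zero, and the product rule splits this integral.\<close>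

lemma set_integral_by_parts:
  assumes \<Omega>: "openin (Rn n) \<Omega>" and i: "i < n" and u: "Ck_on n 1 \<Omega> u" and v: "Ck_on n 1 \<Omega> v"
    and K: "compactin (Rn n) K" "K \<subseteq> \<Omega>" "\<And>p. p \<in> \<Omega> - K \<Longrightarrow> v p = 0"
  shows "set_integrable (lebesgue_Rn n) \<Omega> (\<lambda>p. pderiv_at i u p * v p)"
    and "set_integrable (lebesgue_Rn n) \<Omega> (\<lambda>p. u p * pderiv_at i v p)"
    and "(LINT p:\<Omega>|lebesgue_Rn n. pderiv_at i u p * v p)
      = - (LINT p:\<Omega>|lebesgue_Rn n. u p * pderiv_at i v p)"
proof -
  note c = Ck_on_continuous[OF u] Ck_on_continuous[OF v]
  have c': "continuous_map (subtopology (Rn n) \<Omega>) euclideanreal (pderiv_at i u)"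
    "continuous_map (subtopology (Rn n) \<Omega>) euclideanreal (pderiv_at i v)"
    using u v i by simp_all
  show i1: "set_integrable (lebesgue_Rn n) \<Omega> (\<lambda>p. pderiv_at i u p * v p)"
    using K(3)
    by (intro set_integrable_compact_support[OF \<Omega> K(1,2)] continuous_map_real_mult c(2) c'(1)) simp
  show i2: "set_integrable (lebesgue_Rn n) \<Omega> (\<lambda>p. u p * pderiv_at i v p)"
    using pderiv_at_vanishes[OF \<Omega> K(1,3) _ i]
    by (intro set_integrable_compact_support[OF \<Omega> K(1,2)] continuous_map_real_mult c(1) c'(2)) simp
  have "0 = (LINT p:\<Omega>|lebesgue_Rn n. pderiv_at i (\<lambda>q. u q * v q) p)"
    using K(3) by (intro set_integral_pderiv_eq_0(2)[OF \<Omega> i Ck_on_mult[OF \<Omega> u v] K(1,2), symmetric]) simp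
  also have "\<dots> = (LINT p:\<Omega>|lebesgue_Rn n. pderiv_at i u p * v p + u p * pderiv_at i v p)"
    by (intro set_integral_cong_on pderiv_at_mult[OF u v i])
  also have "\<dots> = (LINT p:\<Omega>|lebesgue_Rn n. pderiv_at i u p * v p)
      + (LINT p:\<Omega>|lebesgue_Rn n. u p * pderiv_at i v p)"
    by (rule set_integral_add(2)[OF i1 i2])
  finally show "(LINT p:\<Omega>|lebesgue_Rn n. pderiv_at i u p * v p)
      = - (LINT p:\<Omega>|lebesgue_Rn n. u p * pderiv_at i v p)"
    by simp
qed

text \<open>
  Testing against product bumps, whose mixed partials commute by inspection, avoids the mean value
  argument.
\<close>

lemma pderiv_at_commute:
  assumes \<Omega>: "openin (Rn n) \<Omega>" and u: "Ck_on n 2 \<Omega> u" and ij: "i < n" "j < n" and p: "p \<in> \<Omega>"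
  shows "pderiv_at i (pderiv_at j u) p = pderiv_at j (pderiv_at i u) p"
proof -
  have u2: "Ck_on n (Suc (Suc 0)) \<Omega> u" using u by (simp only: numeral_2_eq_2)
  have u1: "Ck_on n 1 \<Omega> u" using Ck_on_Suc_imp[OF u2] by simp
  have du: "Ck_on n 1 \<Omega> (pderiv_at k u)" if "k < n" for k
    using Ck_on_pderiv_at[OF u2 that] by simp
  have ddu: "continuous_map (subtopology (Rn n) \<Omega>) euclideanreal (pderiv_at l (pderiv_at k u))"
    if "k < n" "l < n" for k l
    using du[OF that(1)] that(2) by simp
  let ?g = "\<lambda>q. pderiv_at i (pderiv_at j u) q - pderiv_at j (pderiv_at i u) q"
  have "?g p = 0"
  proof (rule fundamental_lemma[OF \<Omega> _ _ p])
    show "continuous_map (subtopology (Rn n) \<Omega>) euclideanreal ?g"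
      using ij by (intro continuous_map_diff ddu)
    fix a b assume test: "test_function n \<Omega> (box_bump n a b)"
    let ?\<phi> = "box_bump n a b"
    obtain K where K: "compactin (Rn n) K" "K \<subseteq> \<Omega>" "\<And>p. p \<in> \<Omega> - K \<Longrightarrow> ?\<phi> p = 0"
      and \<phi>: "\<And>k. Ck_on n k \<Omega> ?\<phi>"
      using test_functionE[OF test \<Omega>] by blast
    have d\<phi>: "Ck_on n 1 \<Omega> (pderiv_at k ?\<phi>)" if "k < n" for k
      using Ck_on_pderiv_at[OF \<phi> that, of 1] .
    \<comment> \<open>Two integrations by parts move both derivatives onto the bump and reverse
      their order. The derivative of the bump again vanishes off \<open>K\<close>, which permits the
      second one.\<close>
    have twice: "(LINT q:\<Omega>|lebesgue_Rn n. pderiv_at k (pderiv_at l u) q * ?\<phi> q)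
        = (LINT q:\<Omega>|lebesgue_Rn n. u q * pderiv_at l (pderiv_at k ?\<phi>) q)"
      if "k < n" "l < n" for k l
      using set_integral_by_parts(3)[OF \<Omega> that(1) du[OF that(2)] \<phi> K]
        set_integral_by_parts(3)[OF \<Omega> that(2) u1 d\<phi>[OF that(1)] K(1,2)
          pderiv_at_vanishes[OF \<Omega> K(1,3) _ that(1)]]
      by simp
    have "(LINT q:\<Omega>|lebesgue_Rn n. ?g q * ?\<phi> q)
        = (LINT q:\<Omega>|lebesgue_Rn n. pderiv_at i (pderiv_at j u) q * ?\<phi> q)
          - (LINT q:\<Omega>|lebesgue_Rn n. pderiv_at j (pderiv_at i u) q * ?\<phi> q)"
      unfolding left_diff_distrib
      using set_integral_by_parts(1)[OF \<Omega> ij(1) du[OF ij(2)] \<phi> K]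
        set_integral_by_parts(1)[OF \<Omega> ij(2) du[OF ij(1)] \<phi> K]
      by (rule set_integral_diff(2))
    also have "\<dots> = 0"
      unfolding twice[OF ij] twice[OF ij(2,1)] pderiv_at_box_bump_commute[OF ij] by simp
    finally show "(LINT q:\<Omega>|lebesgue_Rn n. ?g q * ?\<phi> q) = 0" .
  qed
  then show ?thesis by simp
qed

section \<open>The Euler--Lagrange equation\<close>

definition laplacian :: "nat \<Rightarrow> (point \<Rightarrow> real) \<Rightarrow> point \<Rightarrow> real" where
  "laplacian n u p = (\<Sum>i<n. pderiv_at i (pderiv_at i u) p)"

lemma x_coord_graph: "x_coord (\<lambda>p. (Complex (u p) (v p), t p)) = u"
  and y_coord_graph: "y_coord (\<lambda>p. (Complex (u p) (v p), t p)) = v"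
  by (auto simp: x_coord_def y_coord_def)

locale critical_graph =
  fixes n :: nat and \<Omega> :: "point set" and I :: "real set" and H H' H'' :: "real \<Rightarrow> real"
    and y t :: "point \<Rightarrow> real"
  assumes \<Omega>: "openin (Rn n) \<Omega>" and C2: "C2_on_interval I H H' H''" and yI: "y ` \<Omega> \<subseteq> I"
    and y2: "Ck_on n 2 \<Omega> y"
    and critical: "energy_critical n \<Omega> (\<lambda>p. (Complex (H (y p)) (y p), t p))"
begin

abbreviation D :: "nat \<Rightarrow> point \<Rightarrow> real" where "D i \<equiv> pderiv_at i y"

text \<open>For x = H(y) one has grad x = H'(y) grad y, so this is the factor in |grad z|^2 = (1 +
  H'(y)^2) |grad y|^2.\<close>

definition weight :: "point \<Rightarrow> real" where "weight p = 1 + (H' (y p))\<^sup>2"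

definition stress :: "nat \<Rightarrow> nat \<Rightarrow> point \<Rightarrow> real" where
  "stress \<beta> \<gamma> p = weight p * ((if \<beta> = \<gamma> then 1 else 0) * grad_sq n y p - 2 * (D \<beta> p * D \<gamma> p))"

section \<open>Regularity and divergence of the stress tensor\<close>

lemma H_deriv: "s \<in> I \<Longrightarrow> (H has_real_derivative H' s) (at s within I)"
  and H'_deriv: "s \<in> I \<Longrightarrow> (H' has_real_derivative H'' s) (at s within I)"
  and H''_cont: "continuous_on I H''"
  using C2 by (auto simp: C2_on_interval_def)

lemma H'_cont: "continuous_on I H'"
  using H'_deriv by (rule DERIV_continuous_on)

lemma y_C2: "Ck_on n (Suc 1) \<Omega> y" using y2 by (simp only: numeral_2_eq_2 One_nat_def)

lemma y_C1: "Ck_on n 1 \<Omega> y" using y_C2 by (rule Ck_on_Suc_imp)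

lemma D_C1: "i < n \<Longrightarrow> Ck_on n 1 \<Omega> (D i)" using y_C2 by (rule Ck_on_pderiv_at)

lemma weight_C1: "Ck_on n 1 \<Omega> weight"
  unfolding weight_def
  by (intro Ck_on_add[OF \<Omega>] Ck_on_const[OF \<Omega>] Ck_on_power[OF \<Omega>]
      Ck_on_comp_interval_C1[OF \<Omega> y_C1 yI H'_deriv H''_cont])

lemma stress_C1: "\<beta> < n \<Longrightarrow> \<gamma> < n \<Longrightarrow> Ck_on n 1 \<Omega> (stress \<beta> \<gamma>)"
  \<comment> \<open>The subtraction becomes the addition of a term with constant factor -2, so that
    the rules for sums and products apply.\<close>
  unfolding stress_def grad_sq_def diff_conv_add_uminus mult_minus_left[symmetric]
  by (intro Ck_on_add[OF \<Omega>] Ck_on_mult[OF \<Omega>] Ck_on_const[OF \<Omega>] Ck_on_power[OF \<Omega>]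
      Ck_on_sum[OF \<Omega>] weight_C1 D_C1) auto

lemma pderiv_at_stress:
  assumes "\<beta> < n" "\<gamma> < n" "p \<in> \<Omega>"
  shows "pderiv_at \<beta> (stress \<beta> \<gamma>) p =
    2 * H' (y p) * H'' (y p) * D \<beta> p
      * ((if \<beta> = \<gamma> then 1 else 0) * grad_sq n y p - 2 * (D \<beta> p * D \<gamma> p))
    + weight p * ((if \<beta> = \<gamma> then 1 else 0) * (\<Sum>i<n. 2 * (D i p * pderiv_at \<beta> (D i) p))
        - 2 * (pderiv_at \<beta> (D \<beta>) p * D \<gamma> p + D \<beta> p * pderiv_at \<beta> (D \<gamma>) p))"
proof (rule has_partial_imp_pderiv_at)
  have D: "has_partial \<beta> (D i) (pderiv_at \<beta> (D i) p) p" if "i < n" for i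
    using Ck_on_has_partial[OF D_C1[OF that, unfolded One_nat_def] assms(1,3)] .
  have H': "has_partial \<beta> (\<lambda>p. H' (y p)) (H'' (y p) * D \<beta> p) p"
    using has_partial_comp_interval[OF \<Omega> y_C1 yI H'_deriv H''_cont assms(1,3)] .
  have w: "has_partial \<beta> weight (2 * H' (y p) * H'' (y p) * D \<beta> p) p"
    unfolding weight_def using H' by (auto intro!: derivative_eq_intros)
  have S: "has_partial \<beta> (grad_sq n y) (\<Sum>i<n. 2 * (D i p * pderiv_at \<beta> (D i) p)) p"
    unfolding grad_sq_def
  proof (rule DERIV_sum)
    show "has_partial \<beta> (\<lambda>q. (D i q)\<^sup>2) (2 * (D i p * pderiv_at \<beta> (D i) p)) p" if "i \<in> {..<n}" for i
      using D[of i] that by (auto intro!: derivative_eq_intros)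
  qed
  have e: "has_partial \<beta> (\<lambda>q. (if \<beta> = \<gamma> then 1 else 0) * grad_sq n y q - 2 * (D \<beta> q * D \<gamma> q))
      ((if \<beta> = \<gamma> then 1 else 0) * (\<Sum>i<n. 2 * (D i p * pderiv_at \<beta> (D i) p))
        - 2 * (pderiv_at \<beta> (D \<beta>) p * D \<gamma> p + D \<beta> p * pderiv_at \<beta> (D \<gamma>) p)) p"
    by (intro DERIV_diff DERIV_cmult S has_partial_mult D assms)
  show "has_partial \<beta> (stress \<beta> \<gamma>)
    (2 * H' (y p) * H'' (y p) * D \<beta> p
      * ((if \<beta> = \<gamma> then 1 else 0) * grad_sq n y p - 2 * (D \<beta> p * D \<gamma> p))
    + weight p * ((if \<beta> = \<gamma> then 1 else 0) * (\<Sum>i<n. 2 * (D i p * pderiv_at \<beta> (D i) p))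
        - 2 * (pderiv_at \<beta> (D \<beta>) p * D \<gamma> p + D \<beta> p * pderiv_at \<beta> (D \<gamma>) p))) p"
    unfolding stress_def by (rule has_partial_mult[OF w e])
qed

text \<open>Let S be |grad y|^2 and let Q be the sum of \<open>D i\<close> times the
  \<gamma>-derivative of \<open>D i\<close>. Differentiating S contributes 2 Q, differentiating the
  products \<open>D \<beta> D \<gamma>\<close> contributes -2 Q besides the Laplacian, and the
  derivative of the weight contributes S - 2 S, all times \<open>D \<gamma>\<close> and its
  coefficient.\<close>

lemma divergence_stress:
  assumes \<gamma>: "\<gamma> < n" and p: "p \<in> \<Omega>"
  shows "(\<Sum>\<beta><n. pderiv_at \<beta> (stress \<beta> \<gamma>) p)
    = - 2 * D \<gamma> p * (weight p * laplacian n y p + H'' (y p) * H' (y p) * grad_sq n y p)"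
proof -
  define a where "a = 2 * H' (y p) * H'' (y p)"
  define S where "S = grad_sq n y p"
  define DD where "DD i j = pderiv_at i (D j) p" for i j
  define Q where "Q = (\<Sum>i<n. D i p * DD \<gamma> i)"
  \<comment> \<open>Symmetry of second derivatives enters here: it identifies the sum coming from
    the products \<open>D \<beta> D \<gamma>\<close> with \<open>Q\<close>.\<close>
  have comm: "DD i \<gamma> = DD \<gamma> i" if "i < n" for i
    unfolding DD_def by (rule pderiv_at_commute[OF \<Omega> y2 that \<gamma> p])
  have delta: "(\<Sum>\<beta><n. (if \<beta> = \<gamma> then 1 else 0) * f \<beta>) = f \<gamma>" for f :: "nat \<Rightarrow> real"
    using \<gamma> by (simp add: if_distrib[of "\<lambda>x. x * _"] sum.delta cong: if_cong)
  have "(\<Sum>\<beta><n. pderiv_at \<beta> (stress \<beta> \<gamma>) p)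
    = (\<Sum>\<beta><n. a * ((if \<beta> = \<gamma> then 1 else 0) * (D \<beta> p * S)) - 2 * a * D \<gamma> p * (D \<beta> p)\<^sup>2
        + weight p * ((if \<beta> = \<gamma> then 1 else 0) * (\<Sum>i<n. 2 * (D i p * DD \<beta> i)))
        - 2 * weight p * D \<gamma> p * DD \<beta> \<beta> - 2 * weight p * (D \<beta> p * DD \<gamma> \<beta>))"
  proof (rule sum.cong[OF refl])
    fix \<beta> assume "\<beta> \<in> {..<n}"
    then have \<beta>: "\<beta> < n" by simp
    show "pderiv_at \<beta> (stress \<beta> \<gamma>) p
      = a * ((if \<beta> = \<gamma> then 1 else 0) * (D \<beta> p * S)) - 2 * a * D \<gamma> p * (D \<beta> p)\<^sup>2
        + weight p * ((if \<beta> = \<gamma> then 1 else 0) * (\<Sum>i<n. 2 * (D i p * DD \<beta> i)))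
        - 2 * weight p * D \<gamma> p * DD \<beta> \<beta> - 2 * weight p * (D \<beta> p * DD \<gamma> \<beta>)"
      unfolding pderiv_at_stress[OF \<beta> \<gamma> p] comm[OF \<beta>, symmetric]
      unfolding a_def[symmetric] S_def[symmetric] DD_def[symmetric]
      by (simp only: right_diff_distrib power2_eq_square ring_distribs mult_ac)
  qed
  also have "\<dots> = a * (D \<gamma> p * S) - 2 * a * D \<gamma> p * S + weight p * (2 * Q)
      - 2 * weight p * D \<gamma> p * laplacian n y p - 2 * weight p * Q"
    unfolding sum.distrib sum_subtractf sum_distrib_left[symmetric] delta
    unfolding S_def grad_sq_def laplacian_def Q_def DD_def ..
  also have "\<dots> = - 2 * D \<gamma> p * (weight p * laplacian n y p + H'' (y p) * H' (y p) * grad_sq n y p)"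
    unfolding S_def[symmetric] a_def by (simp add: algebra_simps)
  finally show ?thesis .
qed

text \<open>The chain rule for x = H(y) pulls the common factor \<open>weight\<close> out of the
  first-variation integrand; what remains is the contraction of the stress tensor with the gradient
  of the test function.\<close>

lemma weak_stress:
  assumes \<phi>: "test_function n \<Omega> \<phi>" and \<gamma>: "\<gamma> < n"
  shows "(LINT p:\<Omega>|lebesgue_Rn n. \<Sum>\<beta><n. stress \<beta> \<gamma> p * pderiv_at \<beta> \<phi> p) = 0"
proof -
  have x: "pderiv_at i (\<lambda>p. H (y p)) p = H' (y p) * D i p" if "i < n" "p \<in> \<Omega>" for i p
    by (rule has_partial_imp_pderiv_at[OF has_partial_comp_interval[OF \<Omega> y_C1 yI H_deriv H'_cont that]])
  have "(LINT p:\<Omega>|lebesgue_Rn n. \<Sum>\<beta><n. stress \<beta> \<gamma> p * pderiv_at \<beta> \<phi> p)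
    = (LINT p:\<Omega>|lebesgue_Rn n.
        (grad_sq n (\<lambda>p. H (y p)) p + grad_sq n y p) * pderiv_at \<gamma> \<phi> p
        - 2 * (\<Sum>\<beta><n.
            (pderiv_at \<beta> (\<lambda>p. H (y p)) p * pderiv_at \<gamma> (\<lambda>p. H (y p)) p + D \<beta> p * D \<gamma> p)
            * pderiv_at \<beta> \<phi> p))"
  proof (rule set_integral_cong_on)
    fix p assume p: "p \<in> \<Omega>"
    have grad: "grad_sq n (\<lambda>p. H (y p)) p = (H' (y p))\<^sup>2 * grad_sq n y p"
      unfolding grad_sq_def sum_distrib_left
      by (rule sum.cong) (simp_all add: x p power_mult_distrib)
    have "(\<Sum>\<beta><n. (pderiv_at \<beta> (\<lambda>p. H (y p)) p * pderiv_at \<gamma> (\<lambda>p. H (y p)) p + D \<beta> p * D \<gamma> p)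
            * pderiv_at \<beta> \<phi> p) = weight p * (\<Sum>\<beta><n. D \<beta> p * D \<gamma> p * pderiv_at \<beta> \<phi> p)"
      unfolding sum_distrib_left
      by (rule sum.cong) (simp_all add: x p \<gamma> weight_def power2_eq_square algebra_simps)
    moreover have "(\<Sum>\<beta><n. stress \<beta> \<gamma> p * pderiv_at \<beta> \<phi> p)
      = weight p * grad_sq n y p * (\<Sum>\<beta><n. (if \<beta> = \<gamma> then pderiv_at \<beta> \<phi> p else 0))
        - 2 * weight p * (\<Sum>\<beta><n. D \<beta> p * D \<gamma> p * pderiv_at \<beta> \<phi> p)"
      unfolding sum_distrib_left sum_subtractf[symmetric]
      by (rule sum.cong) (auto simp: stress_def algebra_simps)
    ultimately show "(\<Sum>\<beta><n. stress \<beta> \<gamma> p * pderiv_at \<beta> \<phi> p)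
      = (grad_sq n (\<lambda>p. H (y p)) p + grad_sq n y p) * pderiv_at \<gamma> \<phi> p
        - 2 * (\<Sum>\<beta><n.
            (pderiv_at \<beta> (\<lambda>p. H (y p)) p * pderiv_at \<gamma> (\<lambda>p. H (y p)) p + D \<beta> p * D \<gamma> p)
            * pderiv_at \<beta> \<phi> p)"
      using \<gamma> unfolding grad by (simp add: sum.delta weight_def algebra_simps)
  qed
  also have "\<dots> = 0"
    using critical \<phi> \<gamma> by (simp add: energy_critical_def x_coord_graph y_coord_graph)
  finally show ?thesis .
qed

text \<open>As \<open>y\<close> and \<open>H\<close> are C^2, the stress tensor is C^1. This is just
  enough to shift the derivatives from the bump to the tensor and to have a continuous divergence
  for the fundamental lemma.\<close>

lemma divergence_stress_eq_0:
  assumes \<gamma>: "\<gamma> < n" and p: "p \<in> \<Omega>"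
  shows "(\<Sum>\<beta><n. pderiv_at \<beta> (stress \<beta> \<gamma>) p) = 0"
proof (rule fundamental_lemma[OF \<Omega> _ _ p])
  show "continuous_map (subtopology (Rn n) \<Omega>) euclideanreal (\<lambda>p. \<Sum>\<beta><n. pderiv_at \<beta> (stress \<beta> \<gamma>) p)"
    using stress_C1[OF _ \<gamma>] by (intro continuous_map_sum) auto
  fix a b assume test: "test_function n \<Omega> (box_bump n a b)"
  let ?\<phi> = "box_bump n a b"
  obtain K where K: "compactin (Rn n) K" "K \<subseteq> \<Omega>" "\<And>p. p \<in> \<Omega> - K \<Longrightarrow> ?\<phi> p = 0"
    and \<phi>: "\<And>k. Ck_on n k \<Omega> ?\<phi>"
    using test_functionE[OF test \<Omega>] by blast
  note parts = set_integral_by_parts[OF \<Omega> _ stress_C1[OF _ \<gamma>] \<phi> K]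
  have "(LINT q:\<Omega>|lebesgue_Rn n. (\<Sum>\<beta><n. pderiv_at \<beta> (stress \<beta> \<gamma>) q) * ?\<phi> q)
    = (\<Sum>\<beta><n. LINT q:\<Omega>|lebesgue_Rn n. pderiv_at \<beta> (stress \<beta> \<gamma>) q * ?\<phi> q)"
    unfolding sum_distrib_right by (rule set_integral_sum_on) (use parts(1) in auto)
  also have "\<dots> = (\<Sum>\<beta><n. - (LINT q:\<Omega>|lebesgue_Rn n. stress \<beta> \<gamma> q * pderiv_at \<beta> ?\<phi> q))"
    by (rule sum.cong[OF refl]) (use parts(3) in auto)
  also have "\<dots> = - (LINT q:\<Omega>|lebesgue_Rn n. \<Sum>\<beta><n. stress \<beta> \<gamma> q * pderiv_at \<beta> ?\<phi> q)"
    unfolding sum_negf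
    by (subst set_integral_sum_on) (use parts(2) in auto)
  also have "\<dots> = 0" using weak_stress[OF test \<gamma>] by simp
  finally show "(LINT q:\<Omega>|lebesgue_Rn n. (\<Sum>\<beta><n. pderiv_at \<beta> (stress \<beta> \<gamma>) q) * ?\<phi> q) = 0" .
qed

text \<open>The vector equation says that the scalar \<open>g\<close> times grad y is zero, and grad
  y cannot be divided out at critical points of \<open>y\<close>. If \<open>g\<close> were nonzero
  at \<open>p\<close>, both sides of the claimed equation would be zero there, a
  contradiction.\<close>

lemma laplacian_eq:
  assumes p: "p \<in> \<Omega>"
  shows "laplacian n y p = - (H'' (y p) * H' (y p) / (1 + (H' (y p))\<^sup>2)) * grad_sq n y p"
proof (rule ccontr)
  define g where "g q = weight q * laplacian n y q + H'' (y q) * H' (y q) * grad_sq n y q" for q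
  have weight_pos: "weight q > 0" for q
    by (simp add: weight_def add_pos_nonneg)
  assume neq: "\<not> ?thesis"
  have "g p \<noteq> 0"
  proof
    assume "g p = 0"
    then have "laplacian n y p = - (H'' (y p) * H' (y p) / weight p) * grad_sq n y p"
      using weight_pos[of p] by (simp add: g_def field_simps)
    then show False using neq by (simp add: weight_def)
  qed
  have D0: "D \<gamma> q = 0" if "q \<in> \<Omega>" "g q \<noteq> 0" "\<gamma> < n" for \<gamma> q
    using divergence_stress[OF that(3,1)] divergence_stress_eq_0[OF that(3,1)] that(2)
    by (simp add: g_def)
  note comp = continuous_map_comp_interval[OF \<Omega> y_C1 yI H_deriv H'_cont]
  have "continuous_map (subtopology (Rn n) \<Omega>) euclideanreal g"
    unfolding g_def laplacian_def grad_sq_def power2_eq_square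
    using D_C1
    by (intro continuous_map_add continuous_map_real_mult continuous_map_sum comp
        Ck_on_continuous[OF weight_C1] H'_cont H''_cont Ck_on_continuous[OF D_C1]) auto
  then have "openin (subtopology (Rn n) \<Omega>) {q \<in> topspace (subtopology (Rn n) \<Omega>). g q \<in> - {0}}"
    by (rule openin_continuous_map_preimage) auto
  \<comment> \<open>A zero gradient at \<open>p\<close> alone would leave the second derivatives
    free. They vanish because \<open>y\<close> has zero gradient on this whole neighbourhood of
    \<open>p\<close>.\<close>
  then have W: "openin (Rn n) {q \<in> \<Omega>. g q \<noteq> 0}"
    unfolding topspace_open_subtopology[OF \<Omega>] using openin_trans_full[OF _ \<Omega>] by simp
  have "pderiv_at i (D i) p = 0" if "i < n" for i
  proof -
    have "pderiv_at i (D i) p = pderiv_at i (\<lambda>_. 0) p"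
      using D0[OF _ _ that] p \<open>g p \<noteq> 0\<close> by (intro pderiv_at_cong[OF W _ that]) auto
    then show ?thesis by (simp add: pderiv_at_def)
  qed
  then have "laplacian n y p = 0" by (simp add: laplacian_def)
  moreover have "grad_sq n y p = 0"
    using D0[OF p \<open>g p \<noteq> 0\<close>] by (simp add: grad_sq_def)
  ultimately show False using neq by simp
qed

text \<open>The equation turns the Laplacian term into -h(y) y |grad y|^2 \<eta>^2, where h = H'' H'
  / (1 + H'^2), so an upper bound on h(y) y bounds it from below. All estimates are made under the
  integral sign, against a divergence whose integral is zero.\<close>

lemma caccioppoli:
  assumes \<mu>: "\<mu> < 1" "\<And>p. p \<in> \<Omega> \<Longrightarrow> H'' (y p) * H' (y p) / (1 + (H' (y p))\<^sup>2) * y p \<le> \<mu>"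
    and \<eta>: "test_function n \<Omega> \<eta>"
  shows "(LINT p:\<Omega>|lebesgue_Rn n. grad_sq n y p * (\<eta> p)\<^sup>2)
    \<le> 4 / (1 - \<mu>)\<^sup>2 * (LINT p:\<Omega>|lebesgue_Rn n. grad_sq n \<eta> p * (y p)\<^sup>2)"
proof -
  \<comment> \<open>Absorption leaves the coefficient 1 - \<mu> = 2 \<epsilon> on the energy.
    Young's inequality spends one half of it, and \<epsilon> A \<le> B / \<epsilon> yields the
    constant 1 / \<epsilon>^2.\<close>
  define \<epsilon> where "\<epsilon> = (1 - \<mu>) / 2"
  have \<epsilon>: "\<epsilon> > 0" using \<mu>(1) by (simp add: \<epsilon>_def)
  obtain K where K: "compactin (Rn n) K" "K \<subseteq> \<Omega>" "\<And>p. p \<in> \<Omega> - K \<Longrightarrow> \<eta> p = 0"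
    and \<eta>C: "\<And>k. Ck_on n k \<Omega> \<eta>"
    using test_functionE[OF \<eta> \<Omega>] by blast
  \<comment> \<open>These are the components of the field y \<eta>^2 grad y. It is C^1 since
    \<open>y\<close> is C^2, and it vanishes off \<open>K\<close>.\<close>
  let ?F = "\<lambda>i p. y p * (\<eta> p)\<^sup>2 * D i p"
  have D_cont: "continuous_map (subtopology (Rn n) \<Omega>) euclideanreal (D i)" if "i < n" for i
    using D_C1[OF that] by (rule Ck_on_continuous)
  have \<eta>D_cont: "continuous_map (subtopology (Rn n) \<Omega>) euclideanreal (pderiv_at i \<eta>)" if "i < n" for i
    using Ck_on_pderiv_at[OF \<eta>C that, of 0] by (rule Ck_on_continuous)
  note conts = D_cont \<eta>D_cont Ck_on_continuous[OF y_C1] Ck_on_continuous[OF \<eta>C[of 0]]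
  have F: "Ck_on n 1 \<Omega> (?F i)" if "i < n" for i
    by (intro Ck_on_mult[OF \<Omega>] Ck_on_power[OF \<Omega>] y_C1 \<eta>C D_C1 that)
  have F0: "?F i p = 0" if "p \<in> \<Omega> - K" for i p using K(3)[OF that] by simp
  have dF: "pderiv_at i (?F i) p
      = (D i p)\<^sup>2 * (\<eta> p)\<^sup>2 + 2 * (y p * \<eta> p * pderiv_at i \<eta> p * D i p)
        + y p * (\<eta> p)\<^sup>2 * pderiv_at i (D i) p" if "i < n" "p \<in> \<Omega>" for i p
  proof (rule has_partial_imp_pderiv_at)
    have "has_partial i y (D i p) p" "has_partial i \<eta> (pderiv_at i \<eta> p) p"
      "has_partial i (D i) (pderiv_at i (D i) p) p"
      using that y_C1 \<eta>C[of 1] D_C1[OF that(1)]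
      by (auto intro!: Ck_on_has_partial[of n 0 \<Omega>])
    then show "has_partial i (?F i) ((D i p)\<^sup>2 * (\<eta> p)\<^sup>2 + 2 * (y p * \<eta> p * pderiv_at i \<eta> p * D i p)
        + y p * (\<eta> p)\<^sup>2 * pderiv_at i (D i) p) p"
      by (auto intro!: derivative_eq_intros simp: power2_eq_square algebra_simps)
  qed
  have iA: "set_integrable (lebesgue_Rn n) \<Omega> (\<lambda>p. grad_sq n y p * (\<eta> p)\<^sup>2)"
    unfolding grad_sq_def power2_eq_square
    by (intro set_integrable_compact_support[OF \<Omega> K(1,2)] continuous_map_real_mult
        continuous_map_sum conts) (use K(3) in auto)
  have iB: "set_integrable (lebesgue_Rn n) \<Omega> (\<lambda>p. grad_sq n \<eta> p * (y p)\<^sup>2)"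
    unfolding grad_sq_def power2_eq_square
    by (intro set_integrable_compact_support[OF \<Omega> K(1,2)] continuous_map_real_mult
        continuous_map_sum conts) (use pderiv_at_vanishes[OF \<Omega> K(1,3)] in auto)
  have iF: "set_integrable (lebesgue_Rn n) \<Omega> (pderiv_at i (?F i))" if "i < n" for i
    using set_integrable_pderiv[OF \<Omega> that F[OF that] K(1,2) F0] .
  have pointwise: "\<epsilon> * (grad_sq n y p * (\<eta> p)\<^sup>2) - 1 / \<epsilon> * (grad_sq n \<eta> p * (y p)\<^sup>2)
      \<le> (\<Sum>i<n. pderiv_at i (?F i) p)" if p: "p \<in> \<Omega>" for p
  proof -
    define h where "h = H'' (y p) * H' (y p) / (1 + (H' (y p))\<^sup>2)"
    define S where "S = grad_sq n y p * (\<eta> p)\<^sup>2"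
    have S: "S \<ge> 0" by (simp add: S_def grad_sq_def sum_nonneg)
    have young: "- \<epsilon> * ((D i p)\<^sup>2 * (\<eta> p)\<^sup>2) - 1 / \<epsilon> * ((pderiv_at i \<eta> p)\<^sup>2 * (y p)\<^sup>2)
        \<le> 2 * (y p * \<eta> p * pderiv_at i \<eta> p * D i p)" for i
    proof -
      \<comment> \<open>Expanded, this square divided by \<epsilon> is Young's inequality with the
        weights \<epsilon> and 1 / \<epsilon>.\<close>
      have "0 \<le> (\<epsilon> * (D i p * \<eta> p) + pderiv_at i \<eta> p * y p)\<^sup>2 / \<epsilon>" using \<epsilon> by simp
      then show ?thesis using \<epsilon> by (simp add: power2_eq_square field_simps)
    qed
    have "(\<Sum>i<n. pderiv_at i (?F i) p)
        = S + (\<Sum>i<n. 2 * (y p * \<eta> p * pderiv_at i \<eta> p * D i p)) + y p * (\<eta> p)\<^sup>2 * laplacian n y p"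
      unfolding S_def grad_sq_def laplacian_def sum_distrib_left sum_distrib_right sum.distrib[symmetric]
      by (rule sum.cong) (simp_all add: dF p)
    also have "y p * (\<eta> p)\<^sup>2 * laplacian n y p = - (h * y p * S)"
      unfolding laplacian_eq[OF p] h_def[symmetric] S_def by simp
    finally have eq: "(\<Sum>i<n. pderiv_at i (?F i) p)
        = S - h * y p * S + (\<Sum>i<n. 2 * (y p * \<eta> p * pderiv_at i \<eta> p * D i p))" by simp
    have "h * y p * S \<le> \<mu> * S" using \<mu>(2)[OF p] S unfolding h_def by (rule mult_right_mono)
    moreover have "\<mu> * S = S - 2 * \<epsilon> * S" by (simp add: \<epsilon>_def field_simps)
    moreover have "- \<epsilon> * S - 1 / \<epsilon> * (grad_sq n \<eta> p * (y p)\<^sup>2)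
        \<le> (\<Sum>i<n. 2 * (y p * \<eta> p * pderiv_at i \<eta> p * D i p))"
      unfolding S_def grad_sq_def sum_distrib_left sum_distrib_right sum_subtractf[symmetric]
      by (rule sum_mono) (rule young)
    ultimately show ?thesis unfolding eq S_def[symmetric] by linarith
  qed
  define A where "A = (LINT p:\<Omega>|lebesgue_Rn n. grad_sq n y p * (\<eta> p)\<^sup>2)"
  define B where "B = (LINT p:\<Omega>|lebesgue_Rn n. grad_sq n \<eta> p * (y p)\<^sup>2)"
  have "\<epsilon> * A - 1 / \<epsilon> * B = (LINT p:\<Omega>|lebesgue_Rn n.
      \<epsilon> * (grad_sq n y p * (\<eta> p)\<^sup>2) - 1 / \<epsilon> * (grad_sq n \<eta> p * (y p)\<^sup>2))"
    unfolding A_def B_def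
    by (subst set_integral_diff(2)) (simp_all only: set_integral_mult_right set_integrable_mult_right iA iB)
  also have "\<dots> \<le> (LINT p:\<Omega>|lebesgue_Rn n. \<Sum>i<n. pderiv_at i (?F i) p)"
  proof (rule set_integral_mono[OF _ _ pointwise])
    show "set_integrable (lebesgue_Rn n) \<Omega>
        (\<lambda>p. \<epsilon> * (grad_sq n y p * (\<eta> p)\<^sup>2) - 1 / \<epsilon> * (grad_sq n \<eta> p * (y p)\<^sup>2))"
      by (intro set_integral_diff(1) set_integrable_mult_right iA iB)
    show "set_integrable (lebesgue_Rn n) \<Omega> (\<lambda>p. \<Sum>i<n. pderiv_at i (?F i) p)"
      using iF unfolding set_integrable_def scaleR_sum_right
      by (intro Bochner_Integration.integrable_sum) auto
  qed
  also have "\<dots> = (\<Sum>i<n. LINT p:\<Omega>|lebesgue_Rn n. pderiv_at i (?F i) p)"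
    by (rule set_integral_sum_on) (use iF in auto)
  also have "\<dots> = 0"
    using set_integral_pderiv_eq_0(2)[OF \<Omega> _ F K(1,2) F0] by (intro sum.neutral) auto
  finally have "A \<le> B / \<epsilon>\<^sup>2"
    using \<epsilon> by (simp add: field_simps power2_eq_square)
  then show ?thesis
    unfolding A_def B_def \<epsilon>_def by (simp add: power_divide mult.commute)
qed

end

theorem lemma4p1:
  fixes \<mu> :: real
  assumes "\<mu> < 1"
  shows "\<exists>C>0. \<forall>(n::nat) (\<Omega> :: point set) (I :: real set)
      (H :: real \<Rightarrow> real) (H' :: real \<Rightarrow> real) (H'' :: real \<Rightarrow> real)
      (y :: point \<Rightarrow> real) (t :: point \<Rightarrow> real).
    n \<ge> 1 \<and> bounded_domain n \<Omega> \<and>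
    C2_on_interval I H H' H'' \<and> y ` \<Omega> \<subseteq> I \<and>
    harmonic_curve n \<Omega> (\<lambda>p. (Complex (H (y p)) (y p), t p)) \<and>
    (SUP p\<in>\<Omega>. ereal \<bar>H'' (y p) * H' (y p) / (1 + (H' (y p))\<^sup>2) * y p\<bar>) = ereal \<mu>
    \<longrightarrow> (\<forall>\<eta>. test_function n \<Omega> \<eta> \<longrightarrow>
          (LINT p:\<Omega>|lebesgue_Rn n. grad_sq n y p * (\<eta> p)\<^sup>2)
          \<le> C * (LINT p:\<Omega>|lebesgue_Rn n. grad_sq n \<eta> p * (y p)\<^sup>2))"
\<comment> \<open>The witness is fixed before the dimension, the domain and the map, so it depends
  on \<mu> alone.\<close>
proof (intro exI[of _ "4 / (1 - \<mu>)\<^sup>2"] conjI allI impI)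
  show "4 / (1 - \<mu>)\<^sup>2 > 0" using assms by simp
  fix n :: nat and \<Omega> :: "point set" and I :: "real set" and H H' H'' :: "real \<Rightarrow> real"
    and y t \<eta> :: "point \<Rightarrow> real"
  assume hyp: "n \<ge> 1 \<and> bounded_domain n \<Omega> \<and>
    C2_on_interval I H H' H'' \<and> y ` \<Omega> \<subseteq> I \<and>
    harmonic_curve n \<Omega> (\<lambda>p. (Complex (H (y p)) (y p), t p)) \<and>
    (SUP p\<in>\<Omega>. ereal \<bar>H'' (y p) * H' (y p) / (1 + (H' (y p))\<^sup>2) * y p\<bar>) = ereal \<mu>"
    and \<eta>: "test_function n \<Omega> \<eta>"
  from hyp interpret critical_graph n \<Omega> I H H' H'' y t
    unfolding harmonic_curve_def bounded_domain_def y_coord_graph by unfold_locales auto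
  have "H'' (y p) * H' (y p) / (1 + (H' (y p))\<^sup>2) * y p \<le> \<mu>" if "p \<in> \<Omega>" for p
  proof -
    \<comment> \<open>In the extended reals every value lies below the supremum without a prior
      proof of boundedness.\<close>
    have "ereal \<bar>H'' (y p) * H' (y p) / (1 + (H' (y p))\<^sup>2) * y p\<bar> \<le> ereal \<mu>"
      using hyp that by (metis (no_types, lifting) SUP_upper)
    then show ?thesis unfolding ereal_less_eq by (rule abs_le_D1)
  qed
  then show "(LINT p:\<Omega>|lebesgue_Rn n. grad_sq n y p * (\<eta> p)\<^sup>2)
      \<le> 4 / (1 - \<mu>)\<^sup>2 * (LINT p:\<Omega>|lebesgue_Rn n. grad_sq n \<eta> p * (y p)\<^sup>2)"
    by (rule caccioppoli[OF assms _ \<eta>])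
qed

end
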